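(* Let $\mathcal M\subset\mathbb R^p$ be a submanifold of co-dimension $q$, let $\theta_0\in\mathbb R^p$, and consider the hypotheses $H_0:\theta_0\in\mathcal M$ against $H_1:\theta_0\notin\mathcal M$. Assume that $\widehat\theta\to\theta_0$ almost surely, where under $H_0$ the point $\theta_0$ is $\mathcal M$-nonsingular. Assume that $\widehat A\to A$ in probability with $A$ full rank, and that $\widehat B\to B$ in probability. Assume moreover that $\mathcal L_\infty\big(\sqrt n(\theta_0^*-\widehat\theta_c)\,|\,\widehat P\big)=\mathcal L_\infty\big(\sqrt n(\widehat\theta-\theta_0)\big)$ a.s., that this limit law has a density, and that, conditionally a.s., $A^*\to A$ and $B^*\to B$ in probability. Then for every $\alpha\in(0,1)$, $$\mathbb P_{H_0}\big(\widehat\Lambda>\widehat q(\alpha)\big)\longrightarrow 1-\alpha\qquad\text{and}\qquad \mathbb P_{H_1}\big(\widehat\Lambda>\widehat q(\alpha)\big)\longrightarrow 1$$ as $n\to\infty$; i.e. the test that rejects $H_0$ when $\widehat\Lambda>\widehat q(\alpha)$ is consistent.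
   Context: All limits are as the sample size $n\to\infty$. Hatted quantities are random sequences depending on the sample of size $n$ (e.g. $\widehat\theta\in\mathbb R^p$ is an estimator of $\theta_0$); starred quantities depend on the sample and on additional bootstrap randomness. $\widehat P$ denotes the empirical law of the sample, and conditioning on $\widehat P$ means conditioning on the sample. $\mathcal L_\infty(\cdot)$ is the asymptotic (weak limit) law, and $\mathcal L_\infty(\cdot|\widehat P)$ is the asymptotic law conditionally on the sample. "Conditionally a.s." means: for almost every realization of the sample sequence, the stated convergence holds under the conditional law given the sample. A point $\theta$ is $\mathcal M$-nonsingular if $\theta\in\mathcal M$ and there exist a neighbourhood $V$ of $\theta$ and a function $g:\mathbb R^p\to\mathbb R^q$, continuously differentiable on $V$, with Jacobian $J_g(\theta)$ of full rank, such that $V\cap\mathcal M=\{g=0\}$ (zero set in $V$). $\widehat A,\widehat B,A^*,B^*\in\mathbb R^{p\times p}$ are (random) symmetric positive semi-definite matrices. The constrained estimator and statistic are $$\widehat\theta_c=\operatorname*{argmin}_{\theta\in\mathcal M}(\widehat\theta-\theta)^T\widehat A(\widehat\theta-\theta),\qquad \widehat\Lambda=n(\widehat\theta-\widehat\theta_c)^T\widehat B(\widehat\theta-\widehat\theta_c).$$ The constrained (CS) bootstrap uses a random vector $\theta_0^*=\widehat\theta_c+n^{-1/2}W^*$, where $W^*$ is generated by a bootstrap procedure, and $$\theta_c^*=\operatorname*{argmin}_{\theta\in\mathcal M}(\theta_0^*-\theta)^TA^*(\theta_0^*-\theta),\qquad \Lambda^*=n(\theta_0^*-\theta_c^* )^TB^*(\theta_0^*-\theta_c^*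 ).$$ With $\widehat F$ the cumulative distribution function of $\Lambda^*$ conditionally on the sample, the bootstrap quantile is $\widehat q(\alpha)=\inf\{x:\widehat F(x)\ge\alpha\}$. $\mathbb P_{H_0}$ and $\mathbb P_{H_1}$ denote probability when $H_0$, respectively $H_1$, holds.
   Formalization: Added, as B=0 refutes the claim: under H0, B A^{-1} J^T ≠ 0 (J the Jacobian of g at θ0); under H1, B(θ0−t) ≠ 0 for every A-projection t of θ0 onto the closure of M. Both hold if B has full rank and M is closed. Codimension q ≥ 1. *)

theory Defs
  imports "HOL-Probability.Probability"
begin

definition qform :: "real^'p^'p \<Rightarrow> real^'p \<Rightarrow> real" where
  "qform S x = x \<bullet> (S *v x)"

definition sym_psd :: "real^'p^'p \<Rightarrow> bool" where
  "sym_psd S \<longleftrightarrow> transpose S = S \<and> (\<forall>x. 0 \<le> qform S x)"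

text \<open>Full rank of the Jacobian means row rank \<open>CARD('q)\<close>, which in particular forces
  the codimension to be at most the ambient dimension. As \<open>'q\<close> is a type, the codimension
  is at least one.\<close>

definition defining_map ::
    "(real^'p) set \<Rightarrow> real^'p \<Rightarrow> (real^'p) set \<Rightarrow> (real^'p \<Rightarrow> real^'q) \<Rightarrow> bool" where
  "defining_map M \<theta> V g \<longleftrightarrow>
     open V \<and> \<theta> \<in> V \<and>
     (\<forall>x\<in>V. g differentiable (at x)) \<and>
     continuous_on V (\<lambda>x. jacobian g (at x)) \<and>
     rank (jacobian g (at \<theta>)) = CARD('q) \<and>
     V \<inter> M = {x \<in> V. g x = 0}"

definition nonsingular :: "'q::finite itself \<Rightarrow> (real^'p) set \<Rightarrow> real^'p \<Rightarrow> bool" where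
  "nonsingular _ M \<theta> \<longleftrightarrow> \<theta> \<in> M \<and> (\<exists>V (g :: real^'p \<Rightarrow> real^'q). defining_map M \<theta> V g)"

definition submanifold :: "'q::finite itself \<Rightarrow> (real^'p) set \<Rightarrow> bool" where
  "submanifold q M \<longleftrightarrow> (\<forall>\<theta>\<in>M. nonsingular q M \<theta>)"

text \<open>In the next two definitions the underlying measure may vary with the index, so that they
  also apply to the conditional laws given the sample.\<close>

definition conv_in_prob ::
    "(nat \<Rightarrow> 'a measure) \<Rightarrow> (nat \<Rightarrow> 'a \<Rightarrow> 'b::metric_space) \<Rightarrow> 'b \<Rightarrow> bool" where
  "conv_in_prob P X c \<longleftrightarrow>
     (\<forall>\<epsilon>>0. (\<lambda>n. measure (P n) {x \<in> space (P n). \<epsilon> < dist (X n x) c}) \<longlonglongrightarrow> 0)"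

text \<open>Weak convergence in a general space; the library's \<^const>\<open>weak_conv_m\<close> is restricted
  to the real line.\<close>

definition weak_conv_law ::
    "(nat \<Rightarrow> 'a measure) \<Rightarrow> (nat \<Rightarrow> 'a \<Rightarrow> 'b::topological_space) \<Rightarrow> 'b measure \<Rightarrow> bool" where
  "weak_conv_law P X L \<longleftrightarrow>
     (\<forall>f :: 'b \<Rightarrow> real. continuous_on UNIV f \<longrightarrow> bounded (range f) \<longrightarrow>
        (\<lambda>n. \<integral>y. f y \<partial>distr (P n) borel (X n)) \<longlonglongrightarrow> (\<integral>y. f y \<partial>L))"

definition discrepancy_stat :: "nat \<Rightarrow> real^'p^'p \<Rightarrow> real^'p \<Rightarrow> real^'p \<Rightarrow> real" where
  "discrepancy_stat n S x y = real n * qform S (x - y)"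

definition quantile :: "'a measure \<Rightarrow> ('a \<Rightarrow> real) \<Rightarrow> real \<Rightarrow> real" where
  "quantile P X \<alpha> = Inf {x. \<alpha> \<le> cdf (distr P borel X) x}"

text \<open>A limiting weight \<open>B\<close> that is too degenerate makes the statistic collapse (for \<open>B = 0\<close>
  the test may never reject), so a condition on \<open>B\<close> is needed. At a point of \<open>M\<close> it says
  that \<open>B\<close> does not vanish on the \<open>A\<close>-orthogonal complement of the tangent space, which is the
  range of \<open>A\<^sup>-\<^sup>1 J\<^sup>T\<close>. Off \<open>M\<close> it says that \<open>B\<close> does not vanish on the residual of any
  \<open>A\<close>-projection of the point onto the closure of \<open>M\<close>; this includes that the point is not in
  that closure, as the residual would then be zero. Full rank of \<open>B\<close> and closedness of \<open>M\<close>
  are sufficient, by the two lemmas.\<close>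

definition nondegenerate_null ::
    "'q::finite itself \<Rightarrow> real^'p^'p \<Rightarrow> real^'p^'p \<Rightarrow> (real^'p) set \<Rightarrow> real^'p \<Rightarrow> bool" where
  "nondegenerate_null _ A B M \<theta> \<longleftrightarrow>
     (\<forall>V (g :: real^'p \<Rightarrow> real^'q). defining_map M \<theta> V g \<longrightarrow>
        B ** matrix_inv A ** transpose (jacobian g (at \<theta>)) \<noteq> 0)"

definition nondegenerate_alt ::
    "real^'p^'p \<Rightarrow> real^'p^'p \<Rightarrow> (real^'p) set \<Rightarrow> real^'p \<Rightarrow> bool" where
  "nondegenerate_alt A B M \<theta> \<longleftrightarrow>
     (\<forall>t. is_arg_min (\<lambda>t. qform A (\<theta> - t)) (\<lambda>t. t \<in> closure M) t \<longrightarrow> B *v (\<theta> - t) \<noteq> 0)"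

lemma nondegenerate_null_full_rank:
  fixes A B :: "real^'p^'p"
  assumes "rank A = CARD('p)" "rank B = CARD('p)"
  shows "nondegenerate_null TYPE('q::finite) A B M \<theta>"
proof -
  have inv: "S ** matrix_inv S = mat 1 \<and> matrix_inv S ** S = mat 1"
    if "rank S = CARD('p)" for S :: "real^'p^'p"
  proof -
    have "invertible S"
      using that by (simp add: full_rank_injective invertible_left_inverse
          matrix_left_invertible_injective)
    then show ?thesis
      unfolding matrix_inv_def invertible_def by (rule someI_ex)
  qed
  have "J = 0" if "B ** matrix_inv A ** transpose J = 0" for J :: "real^'p^'q"
  proof -
    have "A ** (matrix_inv B ** (B ** matrix_inv A ** transpose J)) =
        A ** ((matrix_inv B ** B) ** matrix_inv A ** transpose J)"
      by (simp only: matrix_mul_assoc)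
    also have "\<dots> = (A ** matrix_inv A) ** transpose J"
      using inv[OF assms(2)] by (simp add: matrix_mul_assoc)
    also have "\<dots> = transpose J"
      using inv[OF assms(1)] by simp
    finally have "A ** (matrix_inv B ** (B ** matrix_inv A ** transpose J)) = transpose J" .
    then have "transpose J = 0"
      using that by simp
    then show "J = 0"
      by (simp add: transpose_def vec_eq_iff)
  qed
  moreover have "rank (0 :: real^'p^'q) \<noteq> CARD('q)"
    by simp
  ultimately show ?thesis
    unfolding nondegenerate_null_def defining_map_def by metis
qed

lemma nondegenerate_alt_full_rank:
  fixes A B :: "real^'p^'p"
  assumes "rank B = CARD('p)" "closed M" "\<theta> \<notin> M"
  shows "nondegenerate_alt A B M \<theta>"
proof -
  have "inj ((*v) B)"
    using assms(1) by (simp add: full_rank_injective)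
  then have "B *v x \<noteq> 0" if "x \<noteq> 0" for x
    using that by (metis injD matrix_vector_mult_0_right)
  moreover have "\<theta> - t \<noteq> 0" if "t \<in> M" for t
    using assms(3) that by auto
  ultimately show ?thesis
    using assms(2) by (simp add: nondegenerate_alt_def is_arg_min_def)
qed

end

theory Submission
  imports Defs
begin

text \<open>Near a regular point \<open>\<theta>\<close> the constraint set is flat to first order, uniformly over base points
  \<open>m \<in> M\<close> close to \<open>\<theta>\<close>: if \<open>x = m + s w\<close> and \<open>t\<close> minimises the \<open>A\<close>-distance from \<open>x\<close> to \<open>M\<close>,
  then \<open>(x - t) / s\<close> tends to \<open>P w\<close> as \<open>s \<rightarrow> 0\<close>, where \<open>P = A\<^sup>-\<^sup>1 J\<^sup>T (J A\<^sup>-\<^sup>1 J\<^sup>T)\<^sup>-\<^sup>1 J\<close> projects along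
  the tangent space. Under \<open>H\<^sub>0\<close> this applies to the sample, with \<open>m = \<theta>\<^sub>0\<close>, and conditionally to the
  bootstrap, with \<open>m\<close> the constrained estimator, so both statistics have the limit law of the
  quadratic form \<open>(P w)\<^sup>T B (P w)\<close>. It is nonzero by the nondegeneracy condition, hence its level sets
  are Lebesgue null and the limiting distribution function \<open>F\<close> is continuous. As \<open>F\<close> may fail to be
  strictly increasing, the bootstrap quantile need not converge; it is instead bracketed between
  points where \<open>F\<close> equals \<open>\<alpha> \<plusminus> \<epsilon>\<close>.

  Under \<open>H\<^sub>1\<close> the bootstrap statistic is at most a constant times \<open>|W\<^sup>*|\<^sup>2\<close>, because the constrained
  estimator lies in \<open>M\<close>, so the quantile stays bounded, whereas the sample statistic grows at
  least linearly in \<open>n\<close>.\<close>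

section \<open>Quadratic forms\<close>

lemma norm_matrix_vector_mult_le:
  fixes X :: "real^'n^'m"
  shows "norm (X *v x) \<le> norm X * norm x"
proof -
  have "norm (X *v x) \<le> L2_set (\<lambda>i. norm (X $ i) * norm x) UNIV"
    by (subst norm_vec_def, rule L2_set_mono)
      (auto simp: matrix_vector_mul_component Cauchy_Schwarz_ineq2)
  then show ?thesis
    by (simp add: norm_vec_def[of X] L2_set_left_distrib)
qed

lemma bounded_bilinear_matrix_vector_mult:
  "bounded_bilinear ((*v) :: real^'n^'m \<Rightarrow> real^'n \<Rightarrow> real^'m)"
  by standard
    (auto simp: matrix_vector_mult_add_rdistrib matrix_vector_right_distrib
      scaleR_matrix_vector_assoc matrix_vector_mult_scaleR
      intro!: exI[of _ 1] norm_matrix_vector_mult_le)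

lemmas tendsto_matrix_vector_mult [tendsto_intros] =
  bounded_bilinear.tendsto[OF bounded_bilinear_matrix_vector_mult]

lemma continuous_on_matrix_vector_mult [continuous_intros]:
  fixes f :: "'a::topological_space \<Rightarrow> real^'n^'m"
  assumes "continuous_on U f" "continuous_on U h"
  shows "continuous_on U (\<lambda>x. f x *v h x)"
  using bounded_bilinear.continuous_on[OF bounded_bilinear_matrix_vector_mult assms] .

lemma tendsto_qform [tendsto_intros]:
  assumes "(X \<longlongrightarrow> Y) F" "(x \<longlongrightarrow> y) F"
  shows "((\<lambda>k. qform (X k) (x k)) \<longlongrightarrow> qform Y y) F"
  unfolding qform_def by (intro tendsto_intros assms)

lemma continuous_on_qform [continuous_intros]:
  assumes "continuous_on U f" "continuous_on U h"
  shows "continuous_on U (\<lambda>x. qform (f x) (h x))"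
  unfolding qform_def by (intro continuous_intros assms)

lemma qform_scaleR [simp]: "qform X (c *\<^sub>R x) = c\<^sup>2 * qform X x"
  by (simp add: qform_def matrix_vector_mult_scaleR power2_eq_square)

lemma qform_diff: "qform (X - Y) x = qform X x - qform Y x"
  by (simp add: qform_def matrix_vector_mult_diff_rdistrib inner_diff_right)

lemma abs_qform_le: "\<bar>qform X x\<bar> \<le> norm X * (norm x)\<^sup>2"
proof -
  have "\<bar>qform X x\<bar> \<le> norm x * norm (X *v x)"
    unfolding qform_def by (rule Cauchy_Schwarz_ineq2)
  also have "\<dots> \<le> norm x * (norm X * norm x)"
    by (intro mult_left_mono norm_matrix_vector_mult_le) auto
  finally show ?thesis
    by (simp add: power2_eq_square ac_simps)
qed

section \<open>Symmetric and positive semi-definite matrices\<close>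

lemma inner_symmetric_matrix:
  fixes X :: "real^'n^'n"
  assumes "transpose X = X"
  shows "x \<bullet> (X *v y) = (X *v x) \<bullet> y"
  using assms by (metis dot_lmul_matrix transpose_matrix_vector)

lemma qform_add:
  assumes "transpose X = X"
  shows "qform X (x + y) = qform X x + 2 * ((X *v x) \<bullet> y) + qform X y"
  using inner_symmetric_matrix[OF assms, of x y]
  by (simp add: qform_def matrix_vector_right_distrib inner_add_left inner_add_right inner_commute)

lemma sym_psd_transpose: "sym_psd X \<Longrightarrow> transpose X = X"
  and sym_psd_nonneg: "sym_psd X \<Longrightarrow> 0 \<le> qform X x"
  by (simp_all add: sym_psd_def)

text \<open>Cauchy--Schwarz for the semi-inner product of \<open>X\<close>: \<open>qform X (x - s X x) \<ge> 0\<close> for small \<open>s\<close>.\<close>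

lemma sym_psd_kernel:
  assumes X: "sym_psd X" and 0: "qform X x = 0"
  shows "X *v x = 0"
proof (rule ccontr)
  define y where "y = X *v x"
  assume "X *v x \<noteq> 0"
  then have pos: "0 < y \<bullet> y" by (simp add: y_def)
  \<comment> \<open>The bracket \<open>2 * (y \<bullet> y) + s * qform X y\<close> must stay
    positive while \<open>s < 0\<close>. The added one keeps the denominator positive when
    \<open>qform X y = 0\<close> and limits the second term to at most \<open>y \<bullet> y\<close>
    in size.\<close>
  define s where "s = - (y \<bullet> y) / (1 + qform X y)"
  have q: "0 \<le> qform X y" using X by (rule sym_psd_nonneg)
  have s: "s < 0" using pos q by (simp add: s_def divide_neg_pos)
  have "0 \<le> qform X (x + s *\<^sub>R y)"
    using X by (rule sym_psd_nonneg)
  also have "\<dots> = s * (2 * (y \<bullet> y) + s * qform X y)"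
    using 0 by (simp add: qform_add[OF sym_psd_transpose[OF X]] y_def[symmetric]
        power2_eq_square algebra_simps)
  finally have "2 * (y \<bullet> y) + s * qform X y \<le> 0"
    using s by (simp add: zero_le_mult_iff)
  moreover have "s * qform X y \<ge> - (y \<bullet> y)"
  proof -
    have "(y \<bullet> y) * qform X y \<le> (y \<bullet> y) * (1 + qform X y)"
      using pos by (intro mult_left_mono) auto
    then show ?thesis
      using q by (simp add: s_def field_simps)
  qed
  ultimately show False using pos by linarith
qed

text \<open>Serves to pass positive semi-definiteness from the random weights to their limits in
  probability.\<close>

lemma closed_sym_psd: "closed {X :: real^'n^'n. sym_psd X}"
proof -
  have "continuous_on UNIV (\<lambda>X :: real^'n^'n. transpose X)"
    unfolding transpose_def by (intro continuous_intros)
  then have "closed {X :: real^'n^'n. transpose X = X}"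
    by (intro closed_Collect_eq continuous_intros)
  moreover have "closed {X :: real^'n^'n. \<forall>x. 0 \<le> qform X x}"
    by (intro closed_Collect_all closed_Collect_le continuous_intros)
  ultimately show ?thesis
    by (simp add: sym_psd_def closed_Collect_conj)
qed

section \<open>Full rank and coercivity\<close>

lemma full_rank_mult_eq_0:
  fixes X :: "real^'n^'m"
  assumes "rank X = CARD('n)" "X *v x = 0"
  shows "x = 0"
  using assms by (metis full_rank_injective injD matrix_vector_mult_0_right)

lemma full_rank_inverse:
  fixes X :: "real^'n^'n"
  assumes "rank X = CARD('n)"
  shows "X ** matrix_inv X = mat 1" "matrix_inv X ** X = mat 1"
proof -
  have "invertible X"
    using assms by (simp add: full_rank_injective invertible_left_inverse
        matrix_left_invertible_injective)
  then have "X ** matrix_inv X = mat 1 \<and> matrix_inv X ** X = mat 1"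
    unfolding matrix_inv_def invertible_def by (rule someI_ex)
  then show "X ** matrix_inv X = mat 1" "matrix_inv X ** X = mat 1" by auto
qed

text \<open>The constant is the minimum of the form on the compact unit sphere. It is positive
  because a zero of a semi-definite form lies in the kernel, which full rank makes trivial;
  homogeneity extends the bound to all vectors.\<close>

lemma qform_coercive:
  fixes X :: "real^'n^'n"
  assumes X: "sym_psd X" "rank X = CARD('n)"
  obtains c where "0 < c" "\<And>x. c * (norm x)\<^sup>2 \<le> qform X x"
proof -
  have "compact (sphere (0 :: real^'n) 1)" "sphere (0 :: real^'n) 1 \<noteq> {}" by auto
  then obtain u where u: "norm u = 1" "\<And>x. norm x = 1 \<Longrightarrow> qform X u \<le> qform X x"
    using continuous_attains_inf[of "sphere (0 :: real^'n) 1" "qform X"]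
      continuous_on_qform[OF continuous_on_const continuous_on_id, of _ X] by auto
  have "qform X u \<noteq> 0"
    using sym_psd_kernel[OF X(1), of u] full_rank_mult_eq_0[OF X(2), of u] u(1) by auto
  then have "0 < qform X u"
    using sym_psd_nonneg[OF X(1), of u] by linarith
  moreover have "qform X u * (norm x)\<^sup>2 \<le> qform X x" for x
  proof (cases "x = 0")
    case False
    have "qform X u \<le> qform X ((1 / norm x) *\<^sub>R x)"
      using False by (intro u(2)) simp
    then show ?thesis
      using False by (simp only: qform_scaleR) (simp add: field_simps power_divide)
  qed (simp add: qform_def)
  ultimately show ?thesis using that by blast
qed

text \<open>A perturbation of norm at most \<open>c / 2\<close> costs at most half of the coercivity
  constant of \<open>X\<close>, so one constant serves all weights close to the limit.\<close>

lemma qform_coercive_near: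
  assumes X: "sym_psd X" "rank X = CARD('n)"
  obtains c \<delta> where "0 < c" "0 < \<delta>"
    "\<And>Y :: real^'n^'n. \<And>x. dist Y X \<le> \<delta> \<Longrightarrow> c * (norm x)\<^sup>2 \<le> qform Y x"
proof -
  obtain c where c: "0 < c" "\<And>x. c * (norm x)\<^sup>2 \<le> qform X x"
    using qform_coercive[OF X] by metis
  have "c / 2 * (norm x)\<^sup>2 \<le> qform Y x" if "dist Y X \<le> c / 2" for Y :: "real^'n^'n" and x
  proof -
    have "\<bar>qform (Y - X) x\<bar> \<le> norm (Y - X) * (norm x)\<^sup>2"
      by (rule abs_qform_le)
    also have "\<dots> \<le> c / 2 * (norm x)\<^sup>2"
      using that by (intro mult_right_mono) (simp_all add: dist_norm)
    finally show ?thesis using c(2)[of x] unfolding qform_diff by linarith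
  qed
  then show ?thesis using that[of "c / 2" "c / 2"] c(1) by simp
qed

section \<open>Projection onto a constraint set near a regular point\<close>

lemma is_arg_min_le: "is_arg_min f P x \<Longrightarrow> P y \<Longrightarrow> f x \<le> f y" for f :: "'a \<Rightarrow> real"
  by (auto simp: is_arg_min_def not_less)

section \<open>The oblique projection at a regular point\<close>

locale regular_null =
  fixes M :: "(real^'p) set" and \<theta> :: "real^'p" and V and g :: "real^'p \<Rightarrow> real^'q"
    and A B :: "real^'p^'p"
  assumes g: "defining_map M \<theta> V g" and \<theta>_mem: "\<theta> \<in> M"
    and A: "sym_psd A" "rank A = CARD('p)" and B: "sym_psd B"
begin

definition J :: "real^'p^'q" where "J = jacobian g (at \<theta>)"

definition gram :: "real^'q^'q" where "gram = J ** matrix_inv A ** transpose J"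

text \<open>The right inverse of \<open>J\<close> whose range is \<open>A\<close>-orthogonal to the
  kernel of \<open>J\<close>; \<open>lift *v y\<close> is the solution of \<open>J *v x = y\<close>
  of least \<open>A\<close>-norm.\<close>

definition lift :: "real^'q^'p" where "lift = matrix_inv A ** transpose J ** matrix_inv gram"

definition proj :: "real^'p^'p" where "proj = lift ** J"

lemma zero_iff_mem: "x \<in> V \<Longrightarrow> g x = 0 \<longleftrightarrow> x \<in> M"
  using g by (auto simp: defining_map_def)

lemma A_inv: "A *v (matrix_inv A *v x) = x"
  by (simp add: matrix_vector_mul_assoc full_rank_inverse[OF A(2)])

lemma inner_transpose: "x \<bullet> (transpose X *v y) = (X *v x) \<bullet> y" for X :: "real^'n^'m"
  by (metis dot_lmul_matrix transpose_matrix_vector inner_commute)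

text \<open>If \<open>gram\<close> kills \<open>y\<close>, then \<open>z\<close>, the image of
  \<open>y\<close> under \<open>A\<^sup>-\<^sup>1 J\<^sup>T\<close>, is tangent and at the same time
  \<open>A\<close>-orthogonal to all tangent vectors, hence to itself. So \<open>z\<close> vanishes,
  and \<open>y\<close> does too because \<open>J\<close> has full row rank.\<close>

lemma rank_gram: "rank gram = CARD('q)"
proof -
  have "y = 0" if "gram *v y = 0" for y
  proof -
    define z where "z = matrix_inv A *v (transpose J *v y)"
    have Jz: "J *v z = 0"
      using that
      by (simp del: transpose_matrix_vector
          add: gram_def z_def matrix_vector_mul_assoc matrix_mul_assoc)
    have "qform A z = z \<bullet> (transpose J *v y)"
      by (simp add: qform_def z_def A_inv)
    also have "\<dots> = 0"
      by (simp only: inner_transpose Jz inner_zero_left)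
    finally have "A *v z = 0"
      by (intro sym_psd_kernel[OF A(1)])
    then have "transpose J *v y = 0"
      by (simp add: z_def A_inv)
    moreover have "rank (transpose J) = CARD('q)"
      using g by (simp add: defining_map_def J_def rank_transpose)
    ultimately show "y = 0" using full_rank_mult_eq_0 by blast
  qed
  then have "inj ((*v) gram)"
    by (intro injI) (metis eq_iff_diff_eq_0 matrix_vector_mult_diff_distrib)
  then show ?thesis by (simp add: full_rank_injective)
qed

lemma J_lift: "J ** lift = mat 1"
  using full_rank_inverse(1)[OF rank_gram] by (simp add: lift_def gram_def matrix_mul_assoc)

lemma J_lift_mult [simp]: "J *v (lift *v y) = y"
  by (simp add: matrix_vector_mul_assoc J_lift)

lemma J_proj [simp]: "J *v (proj *v w) = J *v w"
  by (simp add: proj_def flip: matrix_vector_mul_assoc)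

lemma A_proj: "A *v (proj *v w) = transpose J *v (matrix_inv gram *v (J *v w))"
  by (simp add: proj_def lift_def A_inv flip: matrix_vector_mul_assoc)

text \<open>Pythagoras for the \<open>A\<close>-inner product: \<open>u - proj *v w\<close> lies in
  the kernel of \<open>J\<close>, while \<open>A *v (proj *v w)\<close> lies in the range of the
  transpose of \<open>J\<close>. Hence \<open>proj *v w\<close> is the vector of least
  \<open>A\<close>-norm among those with the same image under \<open>J\<close>.\<close>

lemma qform_A_decompose:
  assumes "J *v u = J *v w"
  shows "qform A u = qform A (proj *v w) + qform A (u - proj *v w)"
proof -
  have "(A *v (proj *v w)) \<bullet> (u - proj *v w) =
      (matrix_inv gram *v (J *v w)) \<bullet> (J *v (u - proj *v w))"
    by (metis A_proj inner_transpose inner_commute)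
  also have "\<dots> = 0"
    using assms by (simp add: matrix_vector_mult_diff_distrib)
  finally show ?thesis
    using qform_add[OF sym_psd_transpose[OF A(1)], of "proj *v w" "u - proj *v w"] by simp
qed

section \<open>First-order flatness of the constraint set\<close>

text \<open>Continuity of the Jacobian keeps the derivative of \<open>g - J\<close> small on a whole
  ball, and the mean value inequality does the rest. Both points have to vary because the base
  points on \<open>M\<close> are not fixed at \<open>\<theta>\<close>.\<close>

lemma strictly_differentiable:
  assumes "0 < e"
  shows "\<exists>d>0. ball \<theta> d \<subseteq> V \<and>
    (\<forall>x\<in>ball \<theta> d. \<forall>y\<in>ball \<theta> d. norm (g x - g y - J *v (x - y)) \<le> e * norm (x - y))"
proof -
  have V: "open V" "\<theta> \<in> V" "\<And>x. x \<in> V \<Longrightarrow> g differentiable (at x)"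
    "continuous_on V (\<lambda>x. jacobian g (at x))"
    using g by (auto simp: defining_map_def)
  have "((\<lambda>x. jacobian g (at x)) \<longlongrightarrow> J) (at \<theta>)"
    using V by (auto simp: J_def continuous_on_eq_continuous_at isCont_def)
  then obtain d1 where d1: "0 < d1"
    "\<And>x. x \<noteq> \<theta> \<Longrightarrow> dist x \<theta> < d1 \<Longrightarrow> dist (jacobian g (at x)) J < e"
    using \<open>0 < e\<close> unfolding tendsto_iff eventually_at by auto
  obtain d2 where d2: "0 < d2" "ball \<theta> d2 \<subseteq> V"
    using V(1,2) open_contains_ball by blast
  define d where "d = min d1 d2"
  have d: "0 < d" "ball \<theta> d \<subseteq> V"
    using d1 d2 by (auto simp: d_def)
  have near: "norm (jacobian g (at x) - J) \<le> e" if "x \<in> ball \<theta> d" for x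
    using d1(2)[of x] that \<open>0 < e\<close>
    by (cases "x = \<theta>") (auto simp: J_def d_def dist_norm norm_minus_commute less_imp_le)
  have "norm (g x - g y - J *v (x - y)) \<le> e * norm (x - y)"
    if xy: "x \<in> ball \<theta> d" "y \<in> ball \<theta> d" for x y
  proof -
    have "norm ((g x - J *v x) - (g y - J *v y)) \<le> e * norm (x - y)"
    proof (rule differentiable_bound[OF convex_ball _ _ xy])
      fix z assume z: "z \<in> ball \<theta> d"
      then have "(g has_derivative (*v) (jacobian g (at z))) (at z)"
        using V(3)[of z] d(2) jacobian_works[of g "at z"] by auto
      then show "((\<lambda>x. g x - J *v x) has_derivative (\<lambda>h. jacobian g (at z) *v h - J *v h))
          (at z within ball \<theta> d)"
        by (rule has_derivative_diff[OF has_derivative_at_withinI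
            bounded_linear_imp_has_derivative[OF matrix_vector_mul_bounded_linear]])
      show "onorm (\<lambda>h. jacobian g (at z) *v h - J *v h) \<le> e"
      proof (rule onorm_bound)
        fix h
        have "norm ((jacobian g (at z) - J) *v h) \<le> norm (jacobian g (at z) - J) * norm h"
          by (rule norm_matrix_vector_mult_le)
        also have "\<dots> \<le> e * norm h"
          using near[OF z] by (intro mult_right_mono) auto
        finally show "norm (jacobian g (at z) *v h - J *v h) \<le> e * norm h"
          by (simp add: matrix_vector_mult_diff_rdistrib)
      qed (use \<open>0 < e\<close> in auto)
    qed
    then show ?thesis by (simp add: matrix_vector_mult_diff_distrib algebra_simps)
  qed
  with d show ?thesis by blast
qed

text \<open>Both \<open>g x\<close> and \<open>g y\<close> vanish on \<open>M\<close>, so only the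
  linear term survives in the strict differentiability bound.\<close>

lemma chords_almost_tangent:
  assumes "0 < e"
  shows "\<exists>d>0. \<forall>x\<in>M \<inter> ball \<theta> d. \<forall>y\<in>M \<inter> ball \<theta> d. norm (J *v (x - y)) \<le> e * norm (x - y)"
proof -
  obtain d where d: "0 < d" "ball \<theta> d \<subseteq> V"
    "\<And>x y. x \<in> ball \<theta> d \<Longrightarrow> y \<in> ball \<theta> d \<Longrightarrow> norm (g x - g y - J *v (x - y)) \<le> e * norm (x - y)"
    using strictly_differentiable[OF assms] by blast
  have "norm (J *v (x - y)) \<le> e * norm (x - y)" if "x \<in> M \<inter> ball \<theta> d" "y \<in> M \<inter> ball \<theta> d" for x y
  proof -
    have "g x = 0" "g y = 0"
      using that d(2) zero_iff_mem by auto
    then show ?thesis using d(3)[of x y] that by simp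
  qed
  with d(1) show ?thesis by blast
qed

text \<open>With \<open>E x = lift (g x - J x)\<close>, which has small Lipschitz constant near \<open>\<theta>\<close>, the point is
  found as the fixed point of \<open>p \<mapsto> m + h - (E p - E m)\<close>; applying \<open>J\<close> gives \<open>g p = g m\<close>.\<close>

lemma tangent_approximation:
  assumes "0 < e"
  shows "\<exists>d>0. \<forall>m\<in>M \<inter> ball \<theta> d. \<forall>h. J *v h = 0 \<longrightarrow> norm h < d \<longrightarrow>
      (\<exists>p\<in>M. norm (p - m - h) \<le> e * norm h)"
proof -
  \<comment> \<open>\<open>k\<close> is the contraction constant: \<open>k \<le> 1 / 2\<close> makes
    the iteration preserve the ball of radius \<open>2 * norm h\<close>, and
    \<open>2 * k \<le> e\<close> turns the Lipschitz bound on that ball into the required error. The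
    factor \<open>norm lift + 1\<close> in \<open>e'\<close> absorbs the norm of
    \<open>lift\<close>.\<close>
  define k where "k = min e 1 / 2"
  define e' where "e' = k / (norm lift + 1)"
  have k: "0 < k" "k \<le> 1 / 2" "2 * k \<le> e"
    using assms by (auto simp: k_def)
  have pos: "0 < norm lift + 1" by (simp add: add_nonneg_pos)
  then have e': "0 < e'" "norm lift * e' \<le> k"
    using k by (auto simp: e'_def field_simps)
  obtain d where d: "0 < d" "ball \<theta> d \<subseteq> V"
    "\<And>x y. x \<in> ball \<theta> d \<Longrightarrow> y \<in> ball \<theta> d \<Longrightarrow> norm (g x - g y - J *v (x - y)) \<le> e' * norm (x - y)"
    using strictly_differentiable[OF e'(1)] by blast
  define E where "E x = lift *v (g x - J *v x)" for x
  have lip: "norm (E x - E y) \<le> k * norm (x - y)" if "x \<in> ball \<theta> d" "y \<in> ball \<theta> d" for x y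
  proof -
    have "E x - E y = lift *v (g x - g y - J *v (x - y))"
      by (simp add: E_def matrix_vector_mult_diff_distrib)
    also have "norm \<dots> \<le> norm lift * norm (g x - g y - J *v (x - y))"
      by (rule norm_matrix_vector_mult_le)
    also have "\<dots> \<le> norm lift * (e' * norm (x - y))"
      using d(3)[OF that] by (intro mult_left_mono) auto
    also have "\<dots> \<le> k * norm (x - y)"
      using e'(2) by (simp add: mult_right_mono flip: mult.assoc)
    finally show ?thesis .
  qed
  have "\<exists>p\<in>M. norm (p - m - h) \<le> e * norm h"
    if m: "m \<in> M \<inter> ball \<theta> (d / 3)" and h: "J *v h = 0" "norm h < d / 3" for m h
  proof -
    \<comment> \<open>This is the reason for \<open>d / 3\<close>: the base point is within
      \<open>d / 3\<close> of \<open>\<theta>\<close> and the ball around it has radius below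
      \<open>2 * d / 3\<close>.\<close>
    have sub: "cball m (2 * norm h) \<subseteq> ball \<theta> d"
    proof
      fix x assume "x \<in> cball m (2 * norm h)"
      then show "x \<in> ball \<theta> d"
        using m h(2) dist_triangle[of \<theta> x m] by auto
    qed
    have "m \<in> cball m (2 * norm h)" by simp
    then have mb: "m \<in> ball \<theta> d" using sub by blast
    define T where "T p = m + h - (E p - E m)" for p
    have T: "T p \<in> cball m (2 * norm h)" if p: "p \<in> cball m (2 * norm h)" for p
    proof -
      have "norm (E p - E m) \<le> k * norm (p - m)"
        using p mb sub by (intro lip) auto
      also have "\<dots> \<le> 1 / 2 * (2 * norm h)"
        using p k by (intro mult_mono) (auto simp: dist_norm norm_minus_commute)
      finally have "norm (E p - E m - h) \<le> 2 * norm h"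
        using norm_triangle_ineq4[of "E p - E m" h] by simp
      then show ?thesis by (simp add: T_def dist_norm algebra_simps)
    qed
    have "\<exists>!p. p \<in> cball m (2 * norm h) \<and> T p = p"
    proof (rule Banach_fix[OF compact_imp_complete[OF compact_cball], where c = k])
      show "cball m (2 * norm h) \<noteq> {}" by simp
      fix x y assume xy: "x \<in> cball m (2 * norm h)" "y \<in> cball m (2 * norm h)"
      have "dist (T x) (T y) = norm (E x - E y)"
        by (simp add: T_def dist_norm norm_minus_commute)
      also have "\<dots> \<le> k * dist x y"
        unfolding dist_norm using xy sub by (intro lip) auto
      finally show "dist (T x) (T y) \<le> k * dist x y" .
    qed (use k T in auto)
    then obtain p where p: "p \<in> cball m (2 * norm h)" "T p = p" by blast
    have "p - m = h - (E p - E m)"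
      using p(2) by (simp add: T_def algebra_simps)
    then have "J *v (p - m) = J *v (h - (E p - E m))"
      by simp
    also have "\<dots> = - (g p - g m) + J *v (p - m)"
      by (simp add: E_def matrix_vector_mult_diff_distrib h(1))
    finally have "g p = g m" by simp
    moreover have "p \<in> V" "m \<in> V"
      using p(1) mb sub d(2) by auto
    ultimately have "p \<in> M"
      using m zero_iff_mem[of p] zero_iff_mem[of m] by simp
    moreover have "norm (p - m - h) \<le> e * norm h"
    proof -
      have "p - m - h = - (E p - E m)"
        using p(2) by (simp add: T_def algebra_simps)
      then have "norm (p - m - h) = norm (E p - E m)"
        by (metis norm_minus_cancel)
      also have "\<dots> \<le> k * norm (p - m)"
        using p mb sub by (intro lip) auto
      also have "\<dots> \<le> k * (2 * norm h)"
        using p(1) k by (intro mult_left_mono) (auto simp: dist_norm norm_minus_commute)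
      also have "\<dots> \<le> e * norm h"
        using k by (simp add: mult_right_mono flip: mult.assoc)
      finally show ?thesis .
    qed
    ultimately show ?thesis by blast
  qed
  then show ?thesis using d(1) by (intro exI[of _ "d / 3"]) simp
qed

section \<open>Limit of the rescaled residuals\<close>

text \<open>Here \<open>u k\<close> is the residual at the minimiser divided by \<open>s k\<close>.
  Almost tangent chords force \<open>J *v u0 = J *v w0\<close>; competitors built from tangent
  vectors force the \<open>A\<close>-norm of \<open>u0\<close> to be at most that of
  \<open>proj *v w0\<close>. By Pythagoras both together determine \<open>u0\<close>.\<close>

lemma residual_limit:
  fixes s :: "nat \<Rightarrow> real"
  assumes s: "\<And>k. 0 < s k" "s \<longlonglongrightarrow> 0"
    and m: "\<And>k. m k \<in> M" "m \<longlonglongrightarrow> \<theta>"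
    and X: "X \<longlonglongrightarrow> A" and w: "w \<longlonglongrightarrow> w0" and u: "u \<longlonglongrightarrow> u0"
    and t: "\<And>k. t k = m k + s k *\<^sub>R (w k - u k)"
    and opt: "\<And>k. is_arg_min (\<lambda>t. qform (X k) (m k + s k *\<^sub>R w k - t)) (\<lambda>t. t \<in> M) (t k)"
  shows "u0 = proj *v w0"
proof -
  have "(\<lambda>k. m k + s k *\<^sub>R (w k - u k)) \<longlonglongrightarrow> \<theta> + 0 *\<^sub>R (w0 - u0)"
    by (intro tendsto_intros s m w u)
  then have t_lim: "t \<longlonglongrightarrow> \<theta>"
    by (simp add: t[symmetric])
  have tM: "t k \<in> M" for k
    using opt[of k] by (simp add: is_arg_min_def)
  have ball: "\<forall>\<^sub>F k in sequentially. f k \<in> ball \<theta> d" if "f \<longlonglongrightarrow> \<theta>" "0 < d" for f d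
    using tendstoD[OF that] by (simp add: dist_commute)
  \<comment> \<open>The chord from \<open>m k\<close> to \<open>t k\<close> is \<open>s k\<close>
    times \<open>w k - u k\<close>; dividing by \<open>s k\<close> and passing to the limit makes
    \<open>w0 - u0\<close> tangent.\<close>
  have "norm (J *v (w0 - u0)) \<le> e * norm (w0 - u0)" if e: "0 < e" for e
  proof -
    obtain d where d: "0 < d"
      "\<forall>x\<in>M \<inter> ball \<theta> d. \<forall>y\<in>M \<inter> ball \<theta> d. norm (J *v (x - y)) \<le> e * norm (x - y)"
      using chords_almost_tangent[OF e] by blast
    have "\<forall>\<^sub>F k in sequentially. norm (J *v (w k - u k)) \<le> e * norm (w k - u k)"
      using ball[OF t_lim d(1)] ball[OF m(2) d(1)]
    proof eventually_elim
      case (elim k)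
      then have "norm (J *v (t k - m k)) \<le> e * norm (t k - m k)"
        using d(2) tM[of k] m(1)[of k] by blast
      then show ?case
        using s(1)[of k] by (simp add: t matrix_vector_mult_scaleR)
    qed
    moreover have "(\<lambda>k. norm (J *v (w k - u k))) \<longlonglongrightarrow> norm (J *v (w0 - u0))"
      "(\<lambda>k. e * norm (w k - u k)) \<longlonglongrightarrow> e * norm (w0 - u0)"
      by (intro tendsto_intros w u)+
    ultimately show ?thesis
      by (intro tendsto_le[OF trivial_limit_sequentially])
  qed
  then have "norm (J *v (w0 - u0)) \<le> 0"
  proof -
    assume *: "\<And>e. 0 < e \<Longrightarrow> norm (J *v (w0 - u0)) \<le> e * norm (w0 - u0)"
    have "((\<lambda>e. e * norm (w0 - u0)) \<longlongrightarrow> 0 * norm (w0 - u0)) (at_right 0)"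
      by (intro tendsto_intros)
    moreover have "\<forall>\<^sub>F e in at_right 0. norm (J *v (w0 - u0)) \<le> e * norm (w0 - u0)"
      by (rule eventually_mono[OF eventually_at_right_less]) (rule *)
    ultimately show ?thesis
      by (metis mult_zero_left tendsto_lowerbound trivial_limit_at_right_real)
  qed
  then have Ju: "J *v u0 = J *v w0"
    by (simp add: matrix_vector_mult_diff_distrib)

  \<comment> \<open>The tangential part of \<open>w0\<close>. Moving from \<open>m k\<close> by
    \<open>s k *\<^sub>R h\<close> along the constraint set leaves a rescaled residual close to
    \<open>w0 - h = proj *v w0\<close>.\<close>
  define h where "h = w0 - proj *v w0"
  have h: "J *v h = 0" by (simp add: h_def matrix_vector_mult_diff_distrib)
  \<comment> \<open>The point of \<open>M\<close> near \<open>m k + s k *\<^sub>R h\<close> is a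
    competitor, and \<open>z\<close> is its approximation error on the scale \<open>s k\<close>.
    Relative accuracy \<open>1 / (j + 1)\<close> is available only once \<open>k\<close> is large
    depending on \<open>j\<close>, so the comparison is made along indices
    \<open>r j \<ge> j\<close>.\<close>
  have "\<exists>k\<ge>j. \<exists>z. norm z \<le> inverse (Suc j) * norm h \<and> qform (X k) (u k) \<le> qform (X k) (w k - h - z)"
    for j
  proof -
    have "0 < inverse (real (Suc j))" by simp
    from tangent_approximation[OF this] obtain d where d: "0 < d"
      "\<forall>m\<in>M \<inter> ball \<theta> d. \<forall>h. J *v h = 0 \<longrightarrow> norm h < d \<longrightarrow>
        (\<exists>p\<in>M. norm (p - m - h) \<le> inverse (Suc j) * norm h)"
      by blast
    have "(\<lambda>k. s k *\<^sub>R h) \<longlonglongrightarrow> 0 *\<^sub>R h"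
      by (intro tendsto_intros s)
    then have "\<forall>\<^sub>F k in sequentially. norm (s k *\<^sub>R h) < d"
      using d(1) by (auto dest: tendstoD simp: dist_norm)
    with ball[OF m(2) d(1)] eventually_ge_at_top[of j]
    have "\<forall>\<^sub>F k in sequentially. m k \<in> ball \<theta> d \<and> norm (s k *\<^sub>R h) < d \<and> j \<le> k"
      by eventually_elim simp
    then obtain k where k: "m k \<in> ball \<theta> d" "norm (s k *\<^sub>R h) < d" "j \<le> k"
      using eventually_happens' trivial_limit_sequentially by blast
    moreover have "J *v (s k *\<^sub>R h) = 0"
      by (simp add: h matrix_vector_mult_scaleR)
    ultimately obtain p where p: "p \<in> M"
      "norm (p - m k - s k *\<^sub>R h) \<le> inverse (Suc j) * norm (s k *\<^sub>R h)"
      using d(2) m(1)[of k] by blast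
    define z where "z = (1 / s k) *\<^sub>R (p - m k - s k *\<^sub>R h)"
    have sk: "0 < s k" by (rule s)
    have pz: "p = m k + s k *\<^sub>R (h + z)"
      using sk by (simp add: z_def scaleR_add_right)
    have "s k * norm z \<le> s k * (inverse (Suc j) * norm h)"
      using p(2) sk by (simp add: pz scaleR_add_right mult.left_commute)
    then have z: "norm z \<le> inverse (Suc j) * norm h"
      using sk by (simp only: mult_le_cancel_left_pos)
    have "qform (X k) (m k + s k *\<^sub>R w k - t k) \<le> qform (X k) (m k + s k *\<^sub>R w k - p)"
      using is_arg_min_le[OF opt p(1)] .
    also have "m k + s k *\<^sub>R w k - t k = s k *\<^sub>R u k"
      by (simp add: t algebra_simps)
    also have "m k + s k *\<^sub>R w k - p = s k *\<^sub>R (w k - h - z)"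
      by (simp add: pz algebra_simps)
    finally have "qform (X k) (u k) \<le> qform (X k) (w k - h - z)"
      using sk by simp
    with z k(3) show ?thesis by blast
  qed
  then obtain r z where r: "\<And>j. j \<le> r j"
    and z: "\<And>j. norm (z j) \<le> inverse (Suc j) * norm h"
    and le: "\<And>j. qform (X (r j)) (u (r j)) \<le> qform (X (r j)) (w (r j) - h - z j)"
    by metis
  have r_lim: "filterlim r at_top sequentially"
    using r by (intro filterlim_at_top_mono[OF filterlim_ident]) auto
  have "(\<lambda>j. inverse (real (Suc j)) * norm h) \<longlonglongrightarrow> 0 * norm h"
    by (intro tendsto_intros LIMSEQ_inverse_real_of_nat)
  then have z_lim: "z \<longlonglongrightarrow> 0"
    using z by (intro Lim_null_comparison[of z]) auto
  note sub = filterlim_compose[OF _ r_lim]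
  have "qform A u0 \<le> qform A (w0 - h - 0)"
  proof (rule tendsto_le[OF trivial_limit_sequentially])
    show "(\<lambda>j. qform (X (r j)) (w (r j) - h - z j)) \<longlonglongrightarrow> qform A (w0 - h - 0)"
      "(\<lambda>j. qform (X (r j)) (u (r j))) \<longlonglongrightarrow> qform A u0"
      by (intro tendsto_intros sub[OF X] sub[OF u] sub[OF w] z_lim)+
  qed (simp add: le)
  \<comment> \<open>Since \<open>w0 - h\<close> equals \<open>proj *v w0\<close>, the decomposition
    of \<open>qform A u0\<close> cancels the common term and leaves only the deviation.\<close>
  then have "qform A (u0 - proj *v w0) \<le> 0"
    using qform_A_decompose[OF Ju] by (simp add: h_def)
  then have "qform A (u0 - proj *v w0) = 0"
    using sym_psd_nonneg[OF A(1)] by (simp add: order_antisym)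
  then have "u0 - proj *v w0 = 0"
    using sym_psd_kernel[OF A(1)] full_rank_mult_eq_0[OF A(2)] by blast
  then show ?thesis by simp
qed

text \<open>Compactness argument: a failure at every \<open>d\<close> gives sequences whose vectors
  and rescaled residuals are bounded, and along a convergent subsequence
  \<open>residual_limit\<close> identifies the limit and contradicts the gap \<open>e\<close>. The
  radius is uniform in the base point and in \<open>w\<close> of norm at most \<open>R\<close>, as
  random base points and random directions require.\<close>

lemma statistic_approximation:
  assumes "0 < e"
  shows "\<exists>d>0. \<forall>s m X Y w t. 0 < s \<longrightarrow> s < d \<longrightarrow> m \<in> M \<longrightarrow> dist m \<theta> < d \<longrightarrow>
    dist X A \<le> d \<longrightarrow> dist Y B \<le> d \<longrightarrow> norm w \<le> R \<longrightarrow>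
    is_arg_min (\<lambda>t. qform X (m + s *\<^sub>R w - t)) (\<lambda>t. t \<in> M) t \<longrightarrow>
    \<bar>qform Y (m + s *\<^sub>R w - t) / s\<^sup>2 - qform B (proj *v w)\<bar> \<le> e"
proof (rule ccontr)
  assume neg: "\<not> ?thesis"
  obtain c \<delta> where c: "0 < c" "0 < \<delta>"
    "\<And>Y :: real^'p^'p. \<And>x. dist Y A \<le> \<delta> \<Longrightarrow> c * (norm x)\<^sup>2 \<le> qform Y x"
    using qform_coercive_near[OF A] by metis
  \<comment> \<open>Radii tending to zero, capped by \<open>\<delta>\<close> so that the forms
    \<open>X k\<close> are uniformly coercive and by one so that their norms are at most
    \<open>norm A + 1\<close>.\<close>
  define d where "d k = min (min 1 \<delta>) (inverse (real (Suc k)))" for k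
  have d: "0 < d k" "d k \<le> \<delta>" "d k \<le> 1" "d k \<le> inverse (real (Suc k))" for k
    using c(2) by (auto simp: d_def)
  have d_lim: "d \<longlonglongrightarrow> 0"
    using d by (intro tendsto_sandwich[OF _ _ tendsto_const LIMSEQ_inverse_real_of_nat])
      (auto intro!: always_eventually less_imp_le)
  have "\<forall>k. \<exists>s m X Y w t. 0 < s \<and> s < d k \<and> m \<in> M \<and> dist m \<theta> < d k \<and>
    dist X A \<le> d k \<and> dist Y B \<le> d k \<and> norm w \<le> R \<and>
    is_arg_min (\<lambda>t. qform X (m + s *\<^sub>R w - t)) (\<lambda>t. t \<in> M) t \<and>
    e < \<bar>qform Y (m + s *\<^sub>R w - t) / s\<^sup>2 - qform B (proj *v w)\<bar>"
    using neg d(1) by (auto simp: not_le)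
  then obtain s m X Y w t where seq: "\<forall>k. 0 < s k \<and> s k < d k \<and> m k \<in> M \<and> dist (m k) \<theta> < d k \<and>
    dist (X k) A \<le> d k \<and> dist (Y k) B \<le> d k \<and> norm (w k) \<le> R \<and>
    is_arg_min (\<lambda>t. qform (X k) (m k + s k *\<^sub>R w k - t)) (\<lambda>t. t \<in> M) (t k) \<and>
    e < \<bar>qform (Y k) (m k + s k *\<^sub>R w k - t k) / (s k)\<^sup>2 - qform B (proj *v w k)\<bar>"
    unfolding choice_iff by blast
  have s_pos: "0 < s k" for k using seq by blast
  have s: "s \<longlonglongrightarrow> 0"
    using seq by (intro tendsto_sandwich[OF _ _ tendsto_const d_lim])
      (auto intro!: always_eventually less_imp_le)
  have null: "f \<longlonglongrightarrow> l" if "\<And>k. dist (f k) l \<le> d k" for f :: "nat \<Rightarrow> 'z::metric_space" and l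
    using that by (intro metric_tendsto_imp_tendsto[OF d_lim]) (auto simp: abs_of_pos d(1))
  have m: "m \<longlonglongrightarrow> \<theta>" and X: "X \<longlonglongrightarrow> A" and Y: "Y \<longlonglongrightarrow> B"
    using seq by (auto intro!: null intro: less_imp_le)
  define u where "u k = (1 / s k) *\<^sub>R (m k + s k *\<^sub>R w k - t k)" for k
  have su: "m k + s k *\<^sub>R w k - t k = s k *\<^sub>R u k" for k
    using s_pos[of k] by (simp add: u_def)
  have t: "t k = m k + s k *\<^sub>R (w k - u k)" for k
    using su[of k] by (simp add: algebra_simps)
  \<comment> \<open>The base point \<open>m k\<close> is itself a competitor, with residual
    \<open>s k *\<^sub>R w k\<close>; optimality against it and coercivity bound
    \<open>u k\<close>.\<close>
  have u_bd: "(norm (u k))\<^sup>2 \<le> (norm A + 1) * R\<^sup>2 / c" for k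
  proof -
    have "c * (norm (u k))\<^sup>2 \<le> qform (X k) (u k)"
      using seq d(2)[of k] by (intro c(3)) (meson order_trans)
    also have "(s k)\<^sup>2 * qform (X k) (u k) \<le> (s k)\<^sup>2 * qform (X k) (w k)"
      using is_arg_min_le[of "\<lambda>t. qform (X k) (m k + s k *\<^sub>R w k - t)" "\<lambda>t. t \<in> M" "t k" "m k"]
        seq su[of k] by simp
    then have "qform (X k) (u k) \<le> qform (X k) (w k)"
      using s_pos[of k] by simp
    also have "\<dots> \<le> norm (X k) * (norm (w k))\<^sup>2"
      using abs_qform_le[of "X k" "w k"] by simp
    also have "\<dots> \<le> (norm A + 1) * R\<^sup>2"
    proof (intro mult_mono power_mono)
      have "norm (X k - A) \<le> 1" using seq d(3)[of k] by (metis dist_norm order_trans)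
      then show "norm (X k) \<le> norm A + 1"
        using norm_triangle_ineq2[of "X k" A] by simp
    qed (use seq in auto)
    finally show ?thesis using c(1) by (simp add: field_simps)
  qed
  have "bounded (range w)" "bounded (range u)"
    using seq u_bd unfolding bounded_iff by (auto intro: real_le_rsqrt)
  then have "bounded (range w \<times> range u)" by (rule bounded_Times)
  then have "bounded (range (\<lambda>k. (w k, u k)))" by (rule bounded_subset) auto
  \<comment> \<open>Extracting from the pairs yields one subsequence along which both components
    converge.\<close>
  then obtain l r where r: "strict_mono r" "((\<lambda>k. (w k, u k)) \<circ> r) \<longlonglongrightarrow> l"
    using bounded_imp_convergent_subsequence by blast
  obtain w0 u0 where l: "l = (w0, u0)" by (cases l)
  have w0: "(w \<circ> r) \<longlonglongrightarrow> w0" and u0: "(u \<circ> r) \<longlonglongrightarrow> u0"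
    using tendsto_fst[OF r(2)] tendsto_snd[OF r(2)] by (simp_all add: l o_def)
  note sub = LIMSEQ_subseq_LIMSEQ[OF _ r(1)]
  have "u0 = proj *v w0"
    using seq t
    by (intro residual_limit[OF _ sub[OF s] _ sub[OF m] sub[OF X] w0 u0, where t = "t \<circ> r"]) auto
  moreover have "(\<lambda>k. qform ((Y \<circ> r) k) ((u \<circ> r) k) - qform B (proj *v (w \<circ> r) k))
      \<longlonglongrightarrow> qform B u0 - qform B (proj *v w0)"
    by (intro tendsto_intros sub[OF Y] u0 w0)
  ultimately have "(\<lambda>k. qform ((Y \<circ> r) k) ((u \<circ> r) k) - qform B (proj *v (w \<circ> r) k)) \<longlonglongrightarrow> 0"
    by simp
  then have "\<forall>\<^sub>F k in sequentially. \<bar>qform (Y (r k)) (u (r k)) - qform B (proj *v w (r k))\<bar> < e"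
    using assms by (auto dest!: tendstoD simp: dist_norm)
  then obtain k where "\<bar>qform (Y (r k)) (u (r k)) - qform B (proj *v w (r k))\<bar> < e"
    using eventually_happens' trivial_limit_sequentially by blast
  moreover have "e < \<bar>qform (Y k) (u k) - qform B (proj *v w k)\<bar>" for k
    using seq[rule_format, of k] s_pos[of k] by (simp add: su)
  ultimately show False by (metis less_asym)
qed

section \<open>Level sets of the limiting quadratic form\<close>

text \<open>The projection fixes the vectors \<open>w\<close> in the range of
  \<open>A\<^sup>-\<^sup>1 J\<^sup>T\<close>, so there \<open>B *v (proj *v w)\<close> is just
  \<open>B *v w\<close>, and the nondegeneracy condition provides one that is nonzero.\<close>

lemma B_proj_nonzero:
  assumes "B ** matrix_inv A ** transpose J \<noteq> 0"
  obtains w where "B *v (proj *v w) \<noteq> 0"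
proof -
  obtain y where y: "(B ** matrix_inv A ** transpose J) *v y \<noteq> 0"
    using assms by (metis matrix_eq matrix_vector_mult_0)
  define w where "w = matrix_inv A *v (transpose J *v y)"
  have "J *v w = gram *v y"
    by (simp del: transpose_matrix_vector add: gram_def w_def matrix_vector_mul_assoc matrix_mul_assoc)
  then have "A *v (proj *v w) = transpose J *v (matrix_inv gram *v (gram *v y))"
    by (simp only: A_proj)
  also have "matrix_inv gram *v (gram *v y) = y"
    by (simp add: matrix_vector_mul_assoc full_rank_inverse[OF rank_gram])
  also have "transpose J *v y = A *v w"
    by (simp only: w_def A_inv)
  finally have "A *v (proj *v w) = A *v w" .
  then have "A *v (proj *v w - w) = 0"
    by (simp add: matrix_vector_mult_diff_distrib)
  then have "proj *v w = w"
    using full_rank_mult_eq_0[OF A(2)] by fastforce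
  then have "B *v (proj *v w) \<noteq> 0"
    using y by (simp del: transpose_matrix_vector add: w_def matrix_vector_mul_assoc matrix_mul_assoc)
  then show ?thesis using that by blast
qed

text \<open>For \<open>c \<noteq> 0\<close> the form is homogeneous of degree two, so each ray from
  the origin meets the level set at most once. For \<open>c = 0\<close> the level set is the kernel
  of \<open>B ** proj\<close>, a proper subspace.\<close>

lemma negligible_level_set:
  assumes "B ** matrix_inv A ** transpose J \<noteq> 0"
  shows "negligible {w. qform B (proj *v w) = c}"
proof (cases "c = 0")
  case False
  show ?thesis
  proof (rule starlike_negligible[where a = 0])
    show "closed {w. qform B (proj *v w) = c}"
      by (intro closed_Collect_eq continuous_intros)
  next
    fix r x
    assume "0 + r *\<^sub>R x \<in> {w. qform B (proj *v w) = c}" "0 \<le> r" "0 + x \<in> {w. qform B (proj *v w) = c}"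
    then have "r\<^sup>2 * c = c" "0 \<le> r"
      by (auto simp: matrix_vector_mult_scaleR)
    then show "r = 1"
      using False by (simp add: power2_eq_1_iff)
  qed
next
  case True
  have eq: "{w. qform B (proj *v w) = 0} = {w. (B ** proj) *v w = 0}"
    using sym_psd_kernel[OF B] by (auto simp: qform_def simp flip: matrix_vector_mul_assoc)
  have "subspace {w. (B ** proj) *v w = 0}"
    by (intro linear_subspace_kernel matrix_vector_mul_linear)
  moreover have "{w. (B ** proj) *v w = 0} \<noteq> UNIV"
    using B_proj_nonzero[OF assms] by (metis (mono_tags, lifting) UNIV_I matrix_vector_mul_assoc mem_Collect_eq)
  ultimately have "dim {w. (B ** proj) *v w = 0} < DIM(real^'p)"
    by (metis dim_eq_full dim_subset_UNIV le_neq_implies_less span_eq_iff)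
  then show ?thesis
    unfolding True eq by (rule negligible_lowdim)
qed

end

section \<open>Weak convergence and convergence in probability\<close>

text \<open>One half of the Slutsky comparison; it is applied twice, with the statistic and its
  limiting form exchanging roles.\<close>

lemma (in prob_space) prob_approx_le:
  fixes X Y :: "'a \<Rightarrow> real"
  assumes X: "random_variable borel X" and Y: "random_variable borel Y" and E: "E \<in> events"
    and close: "AE b in M. b \<in> E \<longrightarrow> X b \<le> Y b + \<epsilon>"
  shows "prob {b \<in> space M. Y b \<le> y} \<le> prob {b \<in> space M. X b \<le> y + \<epsilon>} + (1 - prob E)"
proof -
  have "prob {b \<in> space M. Y b \<le> y} \<le> prob ({b \<in> space M. X b \<le> y + \<epsilon>} \<union> (space M - E))"
  proof (rule finite_measure_mono_AE)
    show "AE b in M. b \<in> {b \<in> space M. Y b \<le> y} \<longrightarrow>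
        b \<in> {b \<in> space M. X b \<le> y + \<epsilon>} \<union> (space M - E)"
      using close by eventually_elim auto
  qed (use X E in measurable)
  also have "\<dots> \<le> prob {b \<in> space M. X b \<le> y + \<epsilon>} + prob (space M - E)"
    using X by (intro measure_Un_le sets.compl_sets E) measurable
  finally show ?thesis using prob_compl[OF E] by simp
qed

lemma (in prob_space) prob_Int_ge:
  assumes "E \<in> events" "G \<in> events"
  shows "prob E + prob G - 1 \<le> prob (E \<inter> G)"
  using finite_measure_Union'[OF assms] prob_le_1[of "E \<union> G"]
    finite_measure_Diff'[OF assms(2,1)] by (simp add: Int_commute)

text \<open>Dominated convergence for the indicators. It turns what holds eventually for almost
  every sample into events of probability tending to one.\<close>

lemma (in prob_space) conv_prob_1_AE:
  assumes R: "\<And>n. {\<omega> \<in> space M. R n \<omega>} \<in> events"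
    and ev: "AE \<omega> in M. \<forall>\<^sub>F n in sequentially. R n \<omega>"
  shows "(\<lambda>n. prob {\<omega> \<in> space M. R n \<omega>}) \<longlonglongrightarrow> 1"
proof -
  have "(\<lambda>n. \<integral>\<omega>. indicator {\<omega> \<in> space M. R n \<omega>} \<omega> \<partial>M) \<longlonglongrightarrow> (\<integral>\<omega>. (1 :: real) \<partial>M)"
  proof (rule integral_dominated_convergence[where w = "\<lambda>_. 1"])
    show "AE \<omega> in M. (\<lambda>n. indicator {\<omega> \<in> space M. R n \<omega>} \<omega> :: real) \<longlonglongrightarrow> 1"
      using ev AE_space
    proof eventually_elim
      case (elim \<omega>)
      then show ?case
        by (intro tendsto_eventually) (auto elim: eventually_mono)
    qed
  qed (use R in \<open>auto simp: indicator_def\<close>)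
  then show ?thesis using R by (simp add: prob_space)
qed

lemma conv_in_prob_near:
  fixes X :: "nat \<Rightarrow> 'a \<Rightarrow> 'b::euclidean_space"
  assumes conv: "conv_in_prob P X c" and P: "\<And>n. prob_space (P n)"
    and X: "\<And>n. X n \<in> borel_measurable (P n)" and "0 < \<delta>"
  shows "(\<lambda>n. measure (P n) {x \<in> space (P n). dist (X n x) c \<le> \<delta>}) \<longlonglongrightarrow> 1"
proof -
  have "(\<lambda>n. 1 - measure (P n) {x \<in> space (P n). \<delta> < dist (X n x) c}) \<longlonglongrightarrow> 1 - 0"
    using conv \<open>0 < \<delta>\<close> by (intro tendsto_intros) (auto simp: conv_in_prob_def)
  moreover have "1 - measure (P n) {x \<in> space (P n). \<delta> < dist (X n x) c} =
      measure (P n) {x \<in> space (P n). dist (X n x) c \<le> \<delta>}" for n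
  proof -
    interpret prob_space "P n" by (rule P)
    have [measurable]: "X n \<in> borel_measurable (P n)" by (rule X)
    have "{x \<in> space (P n). dist (X n x) c \<le> \<delta>} =
        space (P n) - {x \<in> space (P n). \<delta> < dist (X n x) c}" by auto
    then show ?thesis by (simp add: prob_compl)
  qed
  ultimately show ?thesis by simp
qed

text \<open>An event of positive probability cannot avoid an almost sure one, so arbitrarily close
  to \<open>c\<close> there are values of some \<open>X n\<close> in \<open>C\<close>.\<close>

lemma (in prob_space) conv_in_prob_closed:
  fixes X :: "nat \<Rightarrow> 'a \<Rightarrow> 'b::euclidean_space"
  assumes conv: "conv_in_prob (\<lambda>_. M) X c" and X: "\<And>n. random_variable borel (X n)"
    and C: "closed C" "\<And>n. AE \<omega> in M. X n \<omega> \<in> C"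
  shows "c \<in> C"
proof -
  have "\<exists>y\<in>C. dist y c < e" if "0 < e" for e
  proof -
    have "(\<lambda>n. prob {x \<in> space M. dist (X n x) c \<le> e / 2}) \<longlonglongrightarrow> 1"
      by (rule conv_in_prob_near[OF conv prob_space_axioms X]) (use that in simp)
    then have "\<forall>\<^sub>F n in sequentially. 0 < prob {x \<in> space M. dist (X n x) c \<le> e / 2}"
      by (rule order_tendstoD) simp
    then obtain n where n: "0 < prob {x \<in> space M. dist (X n x) c \<le> e / 2}"
      using eventually_happens' trivial_limit_sequentially by blast
    have "\<exists>x. X n x \<in> C \<and> dist (X n x) c \<le> e / 2"
    proof (rule ccontr)
      assume *: "\<nexists>x. X n x \<in> C \<and> dist (X n x) c \<le> e / 2"
      have "AE x in M. x \<notin> {x \<in> space M. dist (X n x) c \<le> e / 2}"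
        using C(2)[of n] by eventually_elim (use * in blast)
      moreover have "{x \<in> space M. dist (X n x) c \<le> e / 2} \<in> events"
        using X[of n] by measurable
      ultimately have "prob {x \<in> space M. dist (X n x) c \<le> e / 2} = 0"
        using prob_eq_0 by blast
      then show False using n by simp
    qed
    then show ?thesis using that by force
  qed
  then show ?thesis
    using C(1) closure_approachable[of c C] by (simp add: closure_closed)
qed

section \<open>Consequences of weak convergence\<close>

text \<open>A piecewise linear function of \<open>h\<close> fits between the indicators of the
  sublevel sets at \<open>c\<close> and \<open>d\<close>. It is a bounded continuous test function
  thanks to the gap \<open>c < d\<close>, which replaces a condition on the boundary of the sublevel
  set.\<close>

lemma weak_conv_sublevel:
  fixes h :: "'a::euclidean_space \<Rightarrow> real"
  assumes L: "prob_space L" "sets L = sets borel" and h: "continuous_on UNIV h"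
    and P: "\<And>n. prob_space (P n)" and W: "\<And>n. W n \<in> borel_measurable (P n)"
    and conv: "weak_conv_law P W L" and "c < d" "0 < \<eta>"
  shows "\<forall>\<^sub>F n in sequentially. measure (P n) {x \<in> space (P n). h (W n x) \<le> c} <
      measure L {w. h w \<le> d} + \<eta>" (is ?upper)
    and "\<forall>\<^sub>F n in sequentially. measure L {w. h w \<le> c} - \<eta> <
      measure (P n) {x \<in> space (P n). h (W n x) \<le> d}" (is ?lower)
proof -
  define \<phi> where "\<phi> w = max 0 (min 1 ((d - h w) / (d - c)))" for w
  have \<phi>_cont: "continuous_on UNIV \<phi>"
    unfolding \<phi>_def using \<open>c < d\<close> by (intro continuous_intros h) auto
  have \<phi>_01: "0 \<le> \<phi> w" "\<phi> w \<le> 1" for w by (auto simp: \<phi>_def)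
  have \<phi>_lower: "indicator {w. h w \<le> c} w \<le> \<phi> w" for w
    using \<open>c < d\<close> by (auto simp: \<phi>_def indicator_def)
  have \<phi>_upper: "\<phi> w \<le> indicator {w. h w \<le> d} w" for w
    using \<open>c < d\<close> by (auto simp: \<phi>_def indicator_def max_def min_def divide_le_0_iff)
  have [measurable]: "h \<in> borel_measurable borel" "\<phi> \<in> borel_measurable borel"
    using h \<phi>_cont by (auto intro: borel_measurable_continuous_onI)
  \<comment> \<open>Stated for an arbitrary probability space so that it covers both
    \<open>W n\<close> under \<open>P n\<close> and the identity under \<open>L\<close>.\<close>
  have bracket: "measure Q {x \<in> space Q. h (Z x) \<le> c} \<le> (\<integral>x. \<phi> (Z x) \<partial>Q)"
    "(\<integral>x. \<phi> (Z x) \<partial>Q) \<le> measure Q {x \<in> space Q. h (Z x) \<le> d}"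
    if "prob_space Q" and Z[measurable]: "Z \<in> borel_measurable Q" for Q :: "'z measure" and Z
  proof -
    interpret Q: prob_space Q by fact
    have int: "integrable Q (\<lambda>x. \<phi> (Z x))"
      using \<phi>_01 by (intro Q.integrable_const_bound[where B = 1]) auto
    have ind: "(\<integral>x. indicator {x \<in> space Q. h (Z x) \<le> a} x \<partial>Q) = measure Q {x \<in> space Q. h (Z x) \<le> a}"
      "integrable Q (indicator {x \<in> space Q. h (Z x) \<le> a} :: 'z \<Rightarrow> real)" for a
      by (auto intro!: Q.integrable_const_bound[where B = 1])
    have "(\<integral>x. indicator {x \<in> space Q. h (Z x) \<le> c} x \<partial>Q) \<le> (\<integral>x. \<phi> (Z x) \<partial>Q)"
    proof (intro integral_mono ind int)
      fix x show "indicator {x \<in> space Q. h (Z x) \<le> c} x \<le> \<phi> (Z x)"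
        using \<phi>_lower[of "Z x"] \<phi>_01(1)[of "Z x"] by (auto simp: indicator_def split: if_splits)
    qed
    then show "measure Q {x \<in> space Q. h (Z x) \<le> c} \<le> (\<integral>x. \<phi> (Z x) \<partial>Q)"
      by (simp only: ind)
    have "(\<integral>x. \<phi> (Z x) \<partial>Q) \<le> (\<integral>x. indicator {x \<in> space Q. h (Z x) \<le> d} x \<partial>Q)"
    proof (intro integral_mono ind int)
      fix x assume "x \<in> space Q"
      then show "\<phi> (Z x) \<le> indicator {x \<in> space Q. h (Z x) \<le> d} x"
        using \<phi>_upper[of "Z x"] by (auto simp: indicator_def split: if_splits)
    qed
    then show "(\<integral>x. \<phi> (Z x) \<partial>Q) \<le> measure Q {x \<in> space Q. h (Z x) \<le> d}"
      by (simp only: ind)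
  qed
  have space_L: "space L = UNIV"
    using sets_eq_imp_space_eq[OF L(2)] by simp
  have [measurable]: "(\<lambda>w. w) \<in> borel_measurable L"
    by (simp add: measurable_def space_L L(2))
  note bracket_L = bracket[OF L(1), of "\<lambda>w. w", unfolded space_L, simplified]
  have "bounded (range \<phi>)"
    using \<phi>_01 by (auto simp: bounded_iff intro!: exI[of _ 1])
  then have "(\<lambda>n. \<integral>y. \<phi> y \<partial>distr (P n) borel (W n)) \<longlonglongrightarrow> (\<integral>y. \<phi> y \<partial>L)"
    using conv \<phi>_cont by (simp add: weak_conv_law_def)
  then have lim: "(\<lambda>n. \<integral>x. \<phi> (W n x) \<partial>P n) \<longlonglongrightarrow> (\<integral>y. \<phi> y \<partial>L)"
    by (simp add: integral_distr W)
  have "\<forall>\<^sub>F n in sequentially. (\<integral>x. \<phi> (W n x) \<partial>P n) < measure L {w. h w \<le> d} + \<eta>"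
    using bracket_L(2) \<open>0 < \<eta>\<close> by (intro order_tendstoD(2)[OF lim]) simp
  then show ?upper
    by eventually_elim (use bracket(1)[OF P W] in \<open>meson le_less_trans\<close>)
  have "\<forall>\<^sub>F n in sequentially. measure L {w. h w \<le> c} - \<eta> < (\<integral>x. \<phi> (W n x) \<partial>P n)"
    using bracket_L(1) \<open>0 < \<eta>\<close> by (intro order_tendstoD(1)[OF lim]) simp
  then show ?lower
    by eventually_elim (use bracket(2)[OF P W] in \<open>meson less_le_trans\<close>)
qed

text \<open>The radius is read off from \<open>L\<close> alone, before the sequence of measures is
  given, so that the same radius works for the conditional laws of almost every sample.\<close>

lemma weak_conv_tight:
  fixes L :: "'a::euclidean_space measure"
  assumes L: "prob_space L" "sets L = sets borel" and "0 < \<eta>"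
  shows "\<exists>R>0. \<forall>(P :: nat \<Rightarrow> 'b measure) W. (\<forall>n. prob_space (P n)) \<longrightarrow>
    (\<forall>n. W n \<in> borel_measurable (P n)) \<longrightarrow> weak_conv_law P W L \<longrightarrow>
    (\<forall>\<^sub>F n in sequentially. 1 - \<eta> < measure (P n) {x \<in> space (P n). norm (W n x) \<le> R})"
proof -
  interpret L: prob_space L by fact
  have space_L: "space L = UNIV"
    using sets_eq_imp_space_eq[OF L(2)] by simp
  have [measurable]: "norm \<in> borel_measurable L"
    unfolding measurable_cong_sets[OF L(2) refl] by simp
  interpret D: real_distribution "distr L borel norm"
    by (rule L.real_distribution_distr) simp
  \<comment> \<open>Half of \<open>\<eta>\<close> is spent on the tail of \<open>L\<close>, the
    other half on the passage from \<open>L\<close> to \<open>P n\<close>; the final radius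
    \<open>real k + 1\<close> supplies the gap between sublevels.\<close>
  have "\<forall>\<^sub>F k in sequentially. 1 - \<eta> / 2 < cdf (distr L borel norm) (real k)"
    using \<open>0 < \<eta>\<close> by (intro order_tendstoD(1)[OF D.cdf_lim_infty_prob]) simp
  then obtain k where k: "1 - \<eta> / 2 < cdf (distr L borel norm) (real k)"
    using eventually_happens' trivial_limit_sequentially by blast
  have "cdf (distr L borel norm) (real k) = measure L {w. norm w \<le> real k}"
    by (simp add: cdf_def measure_distr space_L vimage_def)
  with k have k: "1 - \<eta> / 2 < measure L {w. norm w \<le> real k}" by simp
  have "\<forall>\<^sub>F n in sequentially. 1 - \<eta> < measure (P n) {x \<in> space (P n). norm (W n x) \<le> real k + 1}"
    if "\<And>n. prob_space (P n)" "\<And>n. W n \<in> borel_measurable (P n)" "weak_conv_law P W L"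
    for P :: "nat \<Rightarrow> 'b measure" and W
  proof -
    have "\<forall>\<^sub>F n in sequentially. measure L {w. norm w \<le> real k} - \<eta> / 2 <
        measure (P n) {x \<in> space (P n). norm (W n x) \<le> real k + 1}"
      using \<open>0 < \<eta>\<close> by (intro weak_conv_sublevel(2)[OF L _ that]) (auto intro: continuous_intros)
    then show ?thesis by eventually_elim (use k in linarith)
  qed
  then show ?thesis by (intro exI[of _ "real k + 1"]) auto
qed

text \<open>A version of Slutsky's theorem. The constants depend only on the limit law, so that it can
  be applied to the conditional laws with a tolerance independent of the sample.\<close>

lemma weak_conv_cdf_perturbed:
  fixes L :: "'a::euclidean_space measure" and Q :: "'a \<Rightarrow> real"
  assumes L: "prob_space L" "sets L = sets borel" and Q: "continuous_on UNIV Q"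
    and atom: "measure L {w. Q w = y} = 0" and "0 < \<eta>"
  shows "\<exists>\<epsilon>>0. \<exists>R>0. \<forall>(P :: nat \<Rightarrow> 'b measure) W \<Lambda> G. (\<forall>n. prob_space (P n)) \<longrightarrow>
    (\<forall>n. W n \<in> borel_measurable (P n)) \<longrightarrow> (\<forall>n. \<Lambda> n \<in> borel_measurable (P n)) \<longrightarrow>
    weak_conv_law P W L \<longrightarrow> (\<forall>n. G n \<in> sets (P n)) \<longrightarrow> (\<lambda>n. measure (P n) (G n)) \<longlonglongrightarrow> 1 \<longrightarrow>
    (\<forall>\<^sub>F n in sequentially.
      (AE b in P n. b \<in> G n \<longrightarrow> norm (W n b) \<le> R \<longrightarrow> \<bar>\<Lambda> n b - Q (W n b)\<bar> \<le> \<epsilon>) \<longrightarrow>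
      \<bar>measure (P n) {b \<in> space (P n). \<Lambda> n b \<le> y} - measure L {w. Q w \<le> y}\<bar> < \<eta>)"
proof -
  interpret L: prob_space L by fact
  have space_L: "space L = UNIV"
    using sets_eq_imp_space_eq[OF L(2)] by simp
  have Q_meas[measurable]: "Q \<in> borel_measurable borel"
    using Q by (rule borel_measurable_continuous_onI)
  have [measurable]: "Q \<in> borel_measurable L"
    unfolding measurable_cong_sets[OF L(2) refl] by simp
  interpret D: real_distribution "distr L borel Q"
    by (rule L.real_distribution_distr) simp
  define F where "F z = measure L {w. Q w \<le> z}" for z
  have cdf_F: "cdf (distr L borel Q) = F"
    by (auto simp: fun_eq_iff F_def cdf_def measure_distr space_L vimage_def)
  have "isCont F y"
    unfolding cdf_F[symmetric] D.isCont_cdf using atom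
    by (simp add: measure_distr space_L vimage_def)
  then obtain r where r: "0 < r" "\<And>z. dist z y < r \<Longrightarrow> dist (F z) (F y) < \<eta> / 4"
    using \<open>0 < \<eta>\<close> unfolding continuous_at_eps_delta by (metis zero_less_divide_iff zero_less_numeral)
  \<comment> \<open>The threshold is shifted by \<open>\<epsilon>\<close> for the perturbation of
    the statistic and by another \<open>\<epsilon>\<close> for the gap in
    \<open>weak_conv_sublevel\<close>, so \<open>2 * \<epsilon>\<close> has to stay below
    \<open>r\<close>. Of the tolerance, \<open>\<eta> / 4\<close> goes to the variation of
    \<open>F\<close>, \<open>\<eta> / 4\<close> to weak convergence and \<open>\<eta> / 2\<close> to
    the two exceptional events.\<close>
  define \<epsilon> where "\<epsilon> = r / 3"
  have \<epsilon>: "0 < \<epsilon>" using r(1) by (simp add: \<epsilon>_def)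
  have F_near: "F (y + 2 * \<epsilon>) < F y + \<eta> / 4" "F y - \<eta> / 4 < F (y - 2 * \<epsilon>)"
  proof -
    have "dist (y + 2 * \<epsilon>) y < r" "dist (y - 2 * \<epsilon>) y < r"
      using r(1) by (auto simp: dist_real_def \<epsilon>_def abs_if)
    from r(2)[OF this(1)] r(2)[OF this(2)]
    show "F (y + 2 * \<epsilon>) < F y + \<eta> / 4" "F y - \<eta> / 4 < F (y - 2 * \<epsilon>)"
      unfolding dist_real_def by linarith+
  qed
  have "0 < \<eta> / 4" using \<open>0 < \<eta>\<close> by simp
  from weak_conv_tight[OF L this] obtain R where R: "0 < R"
    "\<And>(P :: nat \<Rightarrow> 'b measure) W. \<lbrakk>\<forall>n. prob_space (P n); \<forall>n. W n \<in> borel_measurable (P n); weak_conv_law P W L\<rbrakk> \<Longrightarrow>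
      \<forall>\<^sub>F n in sequentially. 1 - \<eta> / 4 < measure (P n) {x \<in> space (P n). norm (W n x) \<le> R}"
    by blast
  have "\<forall>\<^sub>F n in sequentially.
      (AE b in P n. b \<in> G n \<longrightarrow> norm (W n b) \<le> R \<longrightarrow> \<bar>\<Lambda> n b - Q (W n b)\<bar> \<le> \<epsilon>) \<longrightarrow>
      \<bar>measure (P n) {b \<in> space (P n). \<Lambda> n b \<le> y} - F y\<bar> < \<eta>"
    if P: "\<And>n. prob_space (P n)" and W: "\<And>n. W n \<in> borel_measurable (P n)"
      and \<Lambda>: "\<And>n. \<Lambda> n \<in> borel_measurable (P n)" and conv: "weak_conv_law P W L"
      and G: "\<And>n. G n \<in> sets (P n)" and G_lim: "(\<lambda>n. measure (P n) (G n)) \<longlonglongrightarrow> 1"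
    for P :: "nat \<Rightarrow> 'b measure" and W \<Lambda> G
  proof -
    have "\<forall>\<^sub>F n in sequentially. 1 - \<eta> / 4 < measure (P n) (G n)"
      using \<open>0 < \<eta>\<close> by (intro order_tendstoD(1)[OF G_lim]) simp
    moreover have "\<forall>\<^sub>F n in sequentially. 1 - \<eta> / 4 < measure (P n) {x \<in> space (P n). norm (W n x) \<le> R}"
      using R(2) P W conv by blast
    moreover have "\<forall>\<^sub>F n in sequentially. measure (P n) {x \<in> space (P n). Q (W n x) \<le> y + \<epsilon>} <
        F (y + 2 * \<epsilon>) + \<eta> / 4"
      unfolding F_def using \<epsilon> \<open>0 < \<eta>\<close> by (intro weak_conv_sublevel(1)[OF L Q P W conv]) auto
    moreover have "\<forall>\<^sub>F n in sequentially. F (y - 2 * \<epsilon>) - \<eta> / 4 <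
        measure (P n) {x \<in> space (P n). Q (W n x) \<le> y - \<epsilon>}"
      unfolding F_def using \<epsilon> \<open>0 < \<eta>\<close> by (intro weak_conv_sublevel(2)[OF L Q P W conv]) auto
    ultimately show ?thesis
    proof eventually_elim
      case (elim n)
      interpret prob_space "P n" by (rule P)
      have [measurable]: "W n \<in> borel_measurable (P n)" "\<Lambda> n \<in> borel_measurable (P n)"
        "G n \<in> sets (P n)"
        by (fact W \<Lambda> G)+
      define E where "E = G n \<inter> {x \<in> space (P n). norm (W n x) \<le> R}"
      have E: "E \<in> events" unfolding E_def by measurable
      have "prob (G n) + prob {x \<in> space (P n). norm (W n x) \<le> R} - 1 \<le> prob E"
        unfolding E_def by (rule prob_Int_ge) measurable
      with elim(1,2) have pE: "1 - prob E < \<eta> / 2" by argo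
      show ?case
      proof
        assume close: "AE b in P n. b \<in> G n \<longrightarrow> norm (W n b) \<le> R \<longrightarrow> \<bar>\<Lambda> n b - Q (W n b)\<bar> \<le> \<epsilon>"
        have "prob {b \<in> space (P n). \<Lambda> n b \<le> y} \<le>
            prob {b \<in> space (P n). Q (W n b) \<le> y + \<epsilon>} + (1 - prob E)"
        proof (rule prob_approx_le[OF _ _ E])
          show "AE b in P n. b \<in> E \<longrightarrow> Q (W n b) \<le> \<Lambda> n b + \<epsilon>"
            using close by eventually_elim (auto simp: E_def)
        qed measurable
        moreover have "prob {b \<in> space (P n). Q (W n b) \<le> y - \<epsilon>} \<le>
            prob {b \<in> space (P n). \<Lambda> n b \<le> y - \<epsilon> + \<epsilon>} + (1 - prob E)"
        proof (rule prob_approx_le[OF _ _ E])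
          show "AE b in P n. b \<in> E \<longrightarrow> \<Lambda> n b \<le> Q (W n b) + \<epsilon>"
            using close by eventually_elim (auto simp: E_def)
        qed measurable
        ultimately show "\<bar>prob {b \<in> space (P n). \<Lambda> n b \<le> y} - F y\<bar> < \<eta>"
          using elim(3,4) pE F_near by simp
      qed
    qed
  qed
  then show ?thesis
    using \<epsilon> R(1) unfolding F_def by (intro exI[of _ \<epsilon>] exI[of _ R] conjI allI impI) auto
qed

text \<open>By right continuity of the distribution function the infimum is attained. The
  equivalence replaces the quantile by values of the distribution function at fixed points in
  everything that follows.\<close>

lemma quantile_le_iff:
  assumes "prob_space P" "X \<in> borel_measurable P" "0 < \<alpha>" "\<alpha> < 1"
  shows "quantile P X \<alpha> \<le> y \<longleftrightarrow> \<alpha> \<le> measure P {x \<in> space P. X x \<le> y}"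
proof -
  interpret prob_space P by fact
  interpret D: real_distribution "distr P borel X"
    by (rule real_distribution_distr) fact
  interpret cdf: right_continuous_mono "cdf (distr P borel X)" 0 1
    by standard (auto simp: D.cdf_is_right_cont D.cdf_nondecreasing mono_def
        D.cdf_lim_at_bot D.cdf_lim_at_top_prob)
  have "cdf (distr P borel X) y = measure P {x \<in> space P. X x \<le> y}"
    using assms(2) by (simp add: cdf_def measure_distr vimage_def Int_def conj_commute)
  then show ?thesis
    using cdf.pseudoinverse[OF assms(3,4), of y] by (simp add: quantile_def)
qed

section \<open>The test\<close>

lemma conv_prob_1_Int:
  assumes P: "\<And>n. prob_space (P n)" and E: "\<And>n. E n \<in> sets (P n)" "\<And>n. G n \<in> sets (P n)"
    and lim: "(\<lambda>n. measure (P n) (E n)) \<longlonglongrightarrow> 1" "(\<lambda>n. measure (P n) (G n)) \<longlonglongrightarrow> 1"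
  shows "(\<lambda>n. measure (P n) (E n \<inter> G n)) \<longlonglongrightarrow> 1"
proof (rule tendsto_sandwich)
  show "\<forall>\<^sub>F n in sequentially. measure (P n) (E n) + measure (P n) (G n) - 1 \<le> measure (P n) (E n \<inter> G n)"
    by (intro always_eventually allI prob_space.prob_Int_ge P E)
  show "\<forall>\<^sub>F n in sequentially. measure (P n) (E n \<inter> G n) \<le> 1"
    by (intro always_eventually allI prob_space.prob_le_1 P)
  have "(\<lambda>n. measure (P n) (E n) + measure (P n) (G n) - 1) \<longlonglongrightarrow> 1 + 1 - 1"
    by (intro tendsto_intros lim)
  then show "(\<lambda>n. measure (P n) (E n) + measure (P n) (G n) - 1) \<longlonglongrightarrow> 1" by simp
qed simp

section \<open>Constrained minimisers under perturbation of the data\<close>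

text \<open>Optimality against the competitor \<open>m\<close>, with the form bounded below by
  coercivity and above by its norm.\<close>

lemma arg_min_residual_bound:
  assumes coercive: "\<And>v. c * (norm v)\<^sup>2 \<le> qform X v" and X: "norm X \<le> a"
    and opt: "is_arg_min (\<lambda>t. qform X (x - t)) (\<lambda>t. t \<in> M) t" and m: "m \<in> M"
  shows "c * (norm (x - t))\<^sup>2 \<le> a * (norm (x - m))\<^sup>2"
proof -
  have "c * (norm (x - t))\<^sup>2 \<le> qform X (x - t)" by (rule coercive)
  also have "\<dots> \<le> qform X (x - m)"
    using is_arg_min_le[OF opt m] .
  also have "\<dots> \<le> norm X * (norm (x - m))\<^sup>2"
    using abs_qform_le[of X "x - m"] by simp
  also have "\<dots> \<le> a * (norm (x - m))\<^sup>2"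
    using X by (rule mult_right_mono) simp
  finally show ?thesis .
qed

lemma norm_le_of_dist: "dist X A \<le> 1 \<Longrightarrow> norm X \<le> norm A + 1"
  for X A :: "'a::real_normed_vector"
  using norm_triangle_ineq2[of X A] by (simp add: dist_norm)

text \<open>With \<open>\<theta>\<close> itself as competitor the residual is at most a constant
  times \<open>norm (x - \<theta>)\<close>. In this way closeness of the estimator and of its weight
  passes to the constrained estimator.\<close>

lemma arg_min_near:
  fixes A :: "real^'p^'p"
  assumes A: "sym_psd A" "rank A = CARD('p)" and \<theta>: "\<theta> \<in> M" and "0 < e"
  shows "\<exists>d>0. \<forall>X x t. dist X A \<le> d \<longrightarrow> dist x \<theta> \<le> d \<longrightarrow>
    is_arg_min (\<lambda>t. qform X (x - t)) (\<lambda>t. t \<in> M) t \<longrightarrow> dist t \<theta> < e"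
proof -
  obtain c \<delta> where c: "0 < c" "0 < \<delta>"
    "\<And>Y :: real^'p^'p. \<And>x. dist Y A \<le> \<delta> \<Longrightarrow> c * (norm x)\<^sup>2 \<le> qform Y x"
    using qform_coercive_near[OF A] by metis
  define a where "a = norm A + 1"
  have a: "0 < a" by (simp add: a_def add_nonneg_pos)
  \<comment> \<open>\<open>sqrt (a / c)\<close> bounds the residual relative to
    \<open>dist x \<theta>\<close>; the added one accounts for the triangle inequality through
    \<open>x\<close>.\<close>
  define k where "k = sqrt (a / c) + 1"
  have k: "1 \<le> k" using a c(1) by (simp add: k_def)
  define d where "d = min (min 1 \<delta>) (e / (2 * k))"
  have "0 < d" "d \<le> 1" "d \<le> \<delta>" "d \<le> e / (2 * k)"
    using c(2) k \<open>0 < e\<close> by (simp_all add: d_def)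
  then have d: "0 < d" "d \<le> 1" "d \<le> \<delta>" "k * d \<le> e / 2"
    using k by (simp_all add: field_simps)
  have "dist t \<theta> < e"
    if "dist X A \<le> d" "dist x \<theta> \<le> d" and opt: "is_arg_min (\<lambda>t. qform X (x - t)) (\<lambda>t. t \<in> M) t"
    for X x t
  proof -
    have "c * (norm (x - t))\<^sup>2 \<le> a * (norm (x - \<theta>))\<^sup>2"
      using that(1) d by (intro arg_min_residual_bound[OF c(3) _ opt \<theta>])
        (auto simp: a_def intro: norm_le_of_dist)
    then have "(norm (x - t))\<^sup>2 \<le> (sqrt (a / c) * norm (x - \<theta>))\<^sup>2"
      using a c(1) by (simp add: power_mult_distrib field_simps)
    then have "norm (x - t) \<le> sqrt (a / c) * norm (x - \<theta>)"
      using a c(1) by (intro power2_le_imp_le[of "norm (x - t)"]) auto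
    then have "dist t \<theta> \<le> k * dist x \<theta>"
      using dist_triangle3[of t \<theta> x] by (simp add: k_def dist_norm algebra_simps)
    also have "\<dots> \<le> k * d"
      using that(2) k by (intro mult_left_mono) auto
    also have "\<dots> < e" using d(4) \<open>0 < e\<close> by linarith
    finally show ?thesis .
  qed
  then show ?thesis using d(1) by blast
qed

text \<open>Compactness argument: otherwise minimisers subconverge to an \<open>A\<close>-projection
  of \<open>\<theta>\<close> onto the closure of \<open>M\<close> at whose residual \<open>B\<close>
  vanishes, against \<open>nondegenerate_alt\<close>.\<close>

lemma residual_bounded_below:
  fixes A B :: "real^'p^'p"
  assumes A: "sym_psd A" "rank A = CARD('p)" and B: "sym_psd B"
    and alt: "nondegenerate_alt A B M \<theta>"
  shows "\<exists>d>0. \<forall>X Y x t. dist X A \<le> d \<longrightarrow> dist Y B \<le> d \<longrightarrow> dist x \<theta> \<le> d \<longrightarrow>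
    is_arg_min (\<lambda>t. qform X (x - t)) (\<lambda>t. t \<in> M) t \<longrightarrow> d \<le> qform Y (x - t)"
proof (rule ccontr)
  assume neg: "\<not> ?thesis"
  obtain c \<delta> where c: "0 < c" "0 < \<delta>"
    "\<And>Y :: real^'p^'p. \<And>x. dist Y A \<le> \<delta> \<Longrightarrow> c * (norm x)\<^sup>2 \<le> qform Y x"
    using qform_coercive_near[OF A] by metis
  define d where "d k = min (min 1 \<delta>) (inverse (real (Suc k)))" for k
  have d: "0 < d k" "d k \<le> \<delta>" "d k \<le> 1" "d k \<le> inverse (real (Suc k))" for k
    using c(2) by (auto simp: d_def)
  have d_lim: "d \<longlonglongrightarrow> 0"
    using d by (intro tendsto_sandwich[OF _ _ tendsto_const LIMSEQ_inverse_real_of_nat])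
      (auto intro!: always_eventually less_imp_le)
  have "\<forall>k. \<exists>X Y x t. dist X A \<le> d k \<and> dist Y B \<le> d k \<and> dist x \<theta> \<le> d k \<and>
    is_arg_min (\<lambda>t. qform X (x - t)) (\<lambda>t. t \<in> M) t \<and> qform Y (x - t) < d k"
    using neg d(1) by (auto simp: not_le)
  then obtain X Y x t where seq: "\<forall>k. dist (X k) A \<le> d k \<and> dist (Y k) B \<le> d k \<and> dist (x k) \<theta> \<le> d k \<and>
    is_arg_min (\<lambda>t. qform (X k) (x k - t)) (\<lambda>t. t \<in> M) (t k) \<and> qform (Y k) (x k - t k) < d k"
    unfolding choice_iff by blast
  have null: "f \<longlonglongrightarrow> l" if "\<And>k. dist (f k) l \<le> d k" for f :: "nat \<Rightarrow> 'z::metric_space" and l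
    using that by (intro metric_tendsto_imp_tendsto[OF d_lim]) (auto simp: abs_of_pos d(1))
  have x: "x \<longlonglongrightarrow> \<theta>" and X: "X \<longlonglongrightarrow> A" and Y: "Y \<longlonglongrightarrow> B"
    using seq by (auto intro!: null)
  have opt: "is_arg_min (\<lambda>t. qform (X k) (x k - t)) (\<lambda>t. t \<in> M) (t k)" for k
    using seq by blast
  have tM: "t k \<in> M" for k
    using opt[of k] by (simp add: is_arg_min_def)
  have x_bd: "norm (x k) \<le> norm \<theta> + 1" for k
    using seq d(3)[of k] by (intro norm_le_of_dist) (meson order_trans)
  \<comment> \<open>The first minimiser \<open>t 0\<close> is used as a fixed point of
    \<open>M\<close> to compare all the others with.\<close>
  define C where "C = (norm A + 1) * (norm \<theta> + 1 + norm (t 0))\<^sup>2 / c"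
  have res_bd: "(norm (x k - t k))\<^sup>2 \<le> C" for k
  proof -
    have near: "dist (X k) A \<le> \<delta>" "dist (X k) A \<le> 1"
      using seq d(2,3)[of k] by (meson order_trans)+
    have "c * (norm (x k - t k))\<^sup>2 \<le> (norm A + 1) * (norm (x k - t 0))\<^sup>2"
      using arg_min_residual_bound[OF c(3)[OF near(1)] norm_le_of_dist[OF near(2)] opt tM] .
    also have "\<dots> \<le> (norm A + 1) * (norm \<theta> + 1 + norm (t 0))\<^sup>2"
      using norm_triangle_ineq4[of "x k" "t 0"] x_bd[of k] by (intro mult_left_mono power_mono) auto
    finally show ?thesis using c(1) by (simp add: C_def field_simps)
  qed
  have "norm (t k) \<le> sqrt C + (norm \<theta> + 1)" for k
    using real_le_rsqrt[OF res_bd[of k]] x_bd[of k] norm_triangle_ineq3[of "x k" "t k"] by linarith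
  then have "bounded (range t)"
    unfolding bounded_iff by blast
  then obtain t0 r where r: "strict_mono r" "(t \<circ> r) \<longlonglongrightarrow> t0"
    using bounded_imp_convergent_subsequence by blast
  note sub = LIMSEQ_subseq_LIMSEQ[OF _ r(1)]
  have t0: "t0 \<in> closure M"
    using r(2) tM unfolding closure_sequential by (intro exI[of _ "t \<circ> r"]) simp
  \<comment> \<open>Optimality passes to the limit for each fixed competitor in \<open>M\<close>;
    closedness of the inequality then extends it to the closure, where \<open>t0\<close>
    lives.\<close>
  have "M \<subseteq> {m. qform A (\<theta> - t0) \<le> qform A (\<theta> - m)}"
  proof safe
    fix m assume m: "m \<in> M"
    show "qform A (\<theta> - t0) \<le> qform A (\<theta> - m)"
    proof (rule tendsto_le[OF trivial_limit_sequentially])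
      show "(\<lambda>k. qform ((X \<circ> r) k) ((x \<circ> r) k - m)) \<longlonglongrightarrow> qform A (\<theta> - m)"
        "(\<lambda>k. qform ((X \<circ> r) k) ((x \<circ> r) k - (t \<circ> r) k)) \<longlonglongrightarrow> qform A (\<theta> - t0)"
        by (intro tendsto_intros sub[OF X] sub[OF x] r(2))+
    qed (use is_arg_min_le[OF opt m] in simp)
  qed
  moreover have "closed {m. qform A (\<theta> - t0) \<le> qform A (\<theta> - m)}"
    by (intro closed_Collect_le continuous_intros)
  ultimately have "closure M \<subseteq> {m. qform A (\<theta> - t0) \<le> qform A (\<theta> - m)}"
    by (rule closure_minimal)
  with t0 have "is_arg_min (\<lambda>t. qform A (\<theta> - t)) (\<lambda>t. t \<in> closure M) t0"
    by (auto simp: is_arg_min_def not_less)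
  then have "B *v (\<theta> - t0) \<noteq> 0"
    using alt by (simp add: nondegenerate_alt_def)
  then have "0 < qform B (\<theta> - t0)"
    using sym_psd_kernel[OF B, of "\<theta> - t0"] sym_psd_nonneg[OF B, of "\<theta> - t0"] by linarith
  moreover have "qform B (\<theta> - t0) \<le> 0"
  proof (rule tendsto_le[OF trivial_limit_sequentially])
    show "(d \<circ> r) \<longlonglongrightarrow> 0" by (rule sub[OF d_lim])
    show "(\<lambda>k. qform ((Y \<circ> r) k) ((x \<circ> r) k - (t \<circ> r) k)) \<longlonglongrightarrow> qform B (\<theta> - t0)"
      by (intro tendsto_intros sub[OF Y] sub[OF x] r(2))
  qed (use seq in \<open>auto intro!: always_eventually less_imp_le\<close>)
  ultimately show False by simp
qed

section \<open>Asymptotic level with a random critical value\<close>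

text \<open>Closeness of the random distribution functions to the limit is needed only at two fixed
  points, one on either side of the level \<open>\<alpha>\<close>: the equivalence \<open>q\<close>
  converts it into a bracket for the critical value that holds with high probability.\<close>

lemma (in prob_space) bootstrap_test_level:
  fixes \<Lambda> q :: "nat \<Rightarrow> 'a \<Rightarrow> real" and F :: "nat \<Rightarrow> 'a \<Rightarrow> real \<Rightarrow> real" and \<alpha> :: real
  assumes D: "real_distribution D" and cont: "\<And>y. isCont (cdf D) y"
    and [measurable]: "\<And>n. random_variable borel (\<Lambda> n)" "\<And>n y. random_variable borel (\<lambda>\<omega>. F n \<omega> y)"
      "\<And>n. random_variable borel (q n)"
    and q: "\<And>n \<omega> y. \<omega> \<in> space M \<Longrightarrow> q n \<omega> \<le> y \<longleftrightarrow> \<alpha> \<le> F n \<omega> y"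
    and \<Lambda>_lim: "\<And>y. (\<lambda>n. prob {\<omega> \<in> space M. \<Lambda> n \<omega> \<le> y}) \<longlonglongrightarrow> cdf D y"
    and F_lim: "\<And>y \<eta>. 0 < \<eta> \<Longrightarrow>
      (\<lambda>n. prob {\<omega> \<in> space M. \<bar>F n \<omega> y - cdf D y\<bar> < \<eta>}) \<longlonglongrightarrow> 1"
    and \<alpha>: "0 < \<alpha>" "\<alpha> < 1"
  shows "(\<lambda>n. prob {\<omega> \<in> space M. q n \<omega> < \<Lambda> n \<omega>}) \<longlonglongrightarrow> 1 - \<alpha>"
proof (rule metric_LIMSEQ_I)
  fix e :: real assume "0 < e"
  interpret D: real_distribution D by fact
  \<comment> \<open>Three errors of size \<open>\<epsilon>\<close> add up to at most
    \<open>e\<close>, and both \<open>\<alpha> - \<epsilon>\<close> and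
    \<open>\<alpha> + \<epsilon>\<close> lie strictly between zero and one, hence are values of the
    continuous limit.\<close>
  define \<epsilon> where "\<epsilon> = min (e / 3) (min (\<alpha> / 2) ((1 - \<alpha>) / 2))"
  have "0 < \<epsilon>" "\<epsilon> \<le> e / 3" "\<epsilon> \<le> \<alpha> / 2" "\<epsilon> \<le> (1 - \<alpha>) / 2"
    using \<open>0 < e\<close> \<alpha> unfolding \<epsilon>_def min_le_iff_disj min_less_iff_conj by auto
  then have \<epsilon>: "0 < \<epsilon>" "3 * \<epsilon> \<le> e" "\<epsilon> < \<alpha>" "\<alpha> + \<epsilon> < 1"
    using \<alpha> by argo+
  have ivt: "\<exists>y. cdf D y = z" if z: "0 < z" "z < 1" for z
  proof -
    obtain a where a: "cdf D a < z"
      using eventually_happens'[OF trivial_limit_at_bot_linorder order_tendstoD(2)[OF D.cdf_lim_at_bot z(1)]]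
      by blast
    obtain b where b: "z < cdf D b"
      using eventually_happens'[OF trivial_limit_at_top_linorder order_tendstoD(1)[OF D.cdf_lim_at_top_prob z(2)]]
      by blast
    have "a \<le> b"
      using a b D.cdf_nondecreasing[of b a] by linarith
    then show ?thesis
      using IVT[of "cdf D" a z b] a b cont by auto
  qed
  obtain y1 where y1: "cdf D y1 = \<alpha> - \<epsilon>" using ivt[of "\<alpha> - \<epsilon>"] \<epsilon> \<alpha> by auto
  obtain y2 where y2: "cdf D y2 = \<alpha> + \<epsilon>" using ivt[of "\<alpha> + \<epsilon>"] \<epsilon> \<alpha> by auto
  have [measurable]: "{\<omega> \<in> space M. \<Lambda> n \<omega> \<le> y} \<in> events" for n y by measurable
  have [measurable]: "{\<omega> \<in> space M. \<bar>F n \<omega> y - cdf D y\<bar> < \<epsilon>} \<in> events" for n y by measurable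
  have ev: "\<forall>\<^sub>F n in sequentially. \<bar>prob {\<omega> \<in> space M. \<Lambda> n \<omega> \<le> y} - cdf D y\<bar> < \<epsilon> \<and>
      1 - \<epsilon> < prob {\<omega> \<in> space M. \<bar>F n \<omega> y - cdf D y\<bar> < \<epsilon>}" for y
    using tendstoD[OF \<Lambda>_lim \<epsilon>(1)] order_tendstoD(1)[OF F_lim[OF \<epsilon>(1)], of "1 - \<epsilon>"] \<epsilon>(1)
    by (auto simp: dist_real_def eventually_conj_iff)
  have "\<forall>\<^sub>F n in sequentially. dist (prob {\<omega> \<in> space M. q n \<omega> < \<Lambda> n \<omega>}) (1 - \<alpha>) < e"
    using ev[of y1] ev[of y2]
  proof eventually_elim
    case (elim n)
    have compl: "prob {\<omega> \<in> space M. y < \<Lambda> n \<omega>} = 1 - prob {\<omega> \<in> space M. \<Lambda> n \<omega> \<le> y}"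
      for y :: real
      by (subst prob_compl[symmetric]) (auto intro!: arg_cong[where f = prob])
    have compl_q: "prob {\<omega> \<in> space M. q n \<omega> < \<Lambda> n \<omega>} = 1 - prob {\<omega> \<in> space M. \<Lambda> n \<omega> \<le> q n \<omega>}"
      by (subst prob_compl[symmetric]) (measurable, auto intro!: arg_cong[where f = prob])
    \<comment> \<open>Where \<open>F n \<omega> y1\<close> is within \<open>\<epsilon>\<close> of
      \<open>\<alpha> - \<epsilon>\<close> it is below \<open>\<alpha>\<close>, so
      \<open>y1 < q n \<omega>\<close>. The losses are one \<open>\<epsilon>\<close> each from the
      choice of \<open>y1\<close>, the law of \<open>\<Lambda> n\<close> and the exceptional
      event.\<close>
    have "prob {\<omega> \<in> space M. \<Lambda> n \<omega> \<le> y1} + prob {\<omega> \<in> space M. \<bar>F n \<omega> y1 - cdf D y1\<bar> < \<epsilon>} - 1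
        \<le> prob ({\<omega> \<in> space M. \<Lambda> n \<omega> \<le> y1} \<inter> {\<omega> \<in> space M. \<bar>F n \<omega> y1 - cdf D y1\<bar> < \<epsilon>})"
      by (rule prob_Int_ge) measurable
    also have "\<dots> \<le> prob {\<omega> \<in> space M. \<Lambda> n \<omega> \<le> q n \<omega>}"
    proof (rule finite_measure_mono)
      show "{\<omega> \<in> space M. \<Lambda> n \<omega> \<le> y1} \<inter> {\<omega> \<in> space M. \<bar>F n \<omega> y1 - cdf D y1\<bar> < \<epsilon>}
          \<subseteq> {\<omega> \<in> space M. \<Lambda> n \<omega> \<le> q n \<omega>}"
      proof safe
        fix \<omega> assume "\<omega> \<in> space M" "\<Lambda> n \<omega> \<le> y1" "\<bar>F n \<omega> y1 - cdf D y1\<bar> < \<epsilon>"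
        then show "\<Lambda> n \<omega> \<le> q n \<omega>"
          using q[of \<omega> n y1] y1 by linarith
      qed
    qed measurable
    finally have upper: "prob {\<omega> \<in> space M. q n \<omega> < \<Lambda> n \<omega>} < 1 - \<alpha> + 3 * \<epsilon>"
      using elim y1 compl_q by linarith
    \<comment> \<open>Symmetrically, \<open>F n \<omega> y2\<close> exceeds \<open>\<alpha>\<close>
      there, so \<open>q n \<omega> \<le> y2\<close>.\<close>
    have "prob {\<omega> \<in> space M. y2 < \<Lambda> n \<omega>} + prob {\<omega> \<in> space M. \<bar>F n \<omega> y2 - cdf D y2\<bar> < \<epsilon>} - 1
        \<le> prob ({\<omega> \<in> space M. y2 < \<Lambda> n \<omega>} \<inter> {\<omega> \<in> space M. \<bar>F n \<omega> y2 - cdf D y2\<bar> < \<epsilon>})"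
      by (rule prob_Int_ge) measurable
    also have "\<dots> \<le> prob {\<omega> \<in> space M. q n \<omega> < \<Lambda> n \<omega>}"
    proof (rule finite_measure_mono)
      show "{\<omega> \<in> space M. y2 < \<Lambda> n \<omega>} \<inter> {\<omega> \<in> space M. \<bar>F n \<omega> y2 - cdf D y2\<bar> < \<epsilon>}
          \<subseteq> {\<omega> \<in> space M. q n \<omega> < \<Lambda> n \<omega>}"
      proof safe
        fix \<omega> assume "\<omega> \<in> space M" "y2 < \<Lambda> n \<omega>" "\<bar>F n \<omega> y2 - cdf D y2\<bar> < \<epsilon>"
        then show "q n \<omega> < \<Lambda> n \<omega>"
          using q[of \<omega> n y2] y2 by linarith
      qed
    qed measurable
    finally have "1 - \<alpha> - 3 * \<epsilon> < prob {\<omega> \<in> space M. q n \<omega> < \<Lambda> n \<omega>}"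
      using elim y2 compl[of y2] by linarith
    with upper show ?case
      using \<epsilon>(2) by (simp add: dist_real_def abs_less_iff)
  qed
  then show "\<exists>N. \<forall>n\<ge>N. dist (prob {\<omega> \<in> space M. q n \<omega> < \<Lambda> n \<omega>}) (1 - \<alpha>) < e"
    by (simp add: eventually_sequentially)
qed

lemma borel_measurable_qform [measurable (raw)]:
  fixes f :: "'a \<Rightarrow> real^'n^'n" and h :: "'a \<Rightarrow> real^'n"
  assumes "f \<in> borel_measurable N" "h \<in> borel_measurable N"
  shows "(\<lambda>x. qform (f x) (h x)) \<in> borel_measurable N"
  by (rule borel_measurable_continuous_Pair[OF assms]) (intro continuous_intros)

section \<open>A common model for the sample and the bootstrap\<close>

text \<open>Two instances matter: the sample, with constant measure and base point
  \<open>\<theta>\<^sub>0\<close> under the null hypothesis, and the bootstrap for one fixed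
  realisation of the sample, where the base point is the constrained estimator and hence no longer
  random.\<close>

definition projection_model ::
    "(real^'p) set \<Rightarrow> real^'p^'p \<Rightarrow> real^'p^'p \<Rightarrow> (real^'p) measure \<Rightarrow> (nat \<Rightarrow> 'b measure) \<Rightarrow>
     (nat \<Rightarrow> real^'p) \<Rightarrow> (nat \<Rightarrow> 'b \<Rightarrow> real^'p) \<Rightarrow> (nat \<Rightarrow> 'b \<Rightarrow> real^'p) \<Rightarrow>
     (nat \<Rightarrow> 'b \<Rightarrow> real^'p^'p) \<Rightarrow> (nat \<Rightarrow> 'b \<Rightarrow> real^'p^'p) \<Rightarrow> bool" where
  "projection_model M A B L P m x t X Y \<longleftrightarrow>
     (\<forall>n. prob_space (P n) \<and> m n \<in> M \<and>
        x n \<in> borel_measurable (P n) \<and> t n \<in> borel_measurable (P n) \<and>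
        X n \<in> borel_measurable (P n) \<and> Y n \<in> borel_measurable (P n) \<and>
        (AE b in P n. is_arg_min (\<lambda>t. qform (X n b) (x n b - t)) (\<lambda>t. t \<in> M) (t n b))) \<and>
     weak_conv_law P (\<lambda>n b. sqrt (real n) *\<^sub>R (x n b - m n)) L \<and>
     conv_in_prob P X A \<and> conv_in_prob P Y B"

lemma projection_modelD:
  assumes "projection_model M A B L P m x t X Y"
  shows "prob_space (P n)" "m n \<in> M"
    "x n \<in> borel_measurable (P n)" "t n \<in> borel_measurable (P n)"
    "X n \<in> borel_measurable (P n)" "Y n \<in> borel_measurable (P n)"
    "AE b in P n. is_arg_min (\<lambda>t. qform (X n b) (x n b - t)) (\<lambda>t. t \<in> M) (t n b)"
    "(\<lambda>b. sqrt (real n) *\<^sub>R (x n b - m n)) \<in> borel_measurable (P n)"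
    "(\<lambda>b. discrepancy_stat n (Y n b) (x n b) (t n b)) \<in> borel_measurable (P n)"
    "weak_conv_law P (\<lambda>n b. sqrt (real n) *\<^sub>R (x n b - m n)) L"
proof -
  show [measurable]: "x n \<in> borel_measurable (P n)" "t n \<in> borel_measurable (P n)"
    "X n \<in> borel_measurable (P n)" "Y n \<in> borel_measurable (P n)"
    using assms by (auto simp: projection_model_def)
  show "(\<lambda>b. sqrt (real n) *\<^sub>R (x n b - m n)) \<in> borel_measurable (P n)" by measurable
  show "(\<lambda>b. discrepancy_stat n (Y n b) (x n b) (t n b)) \<in> borel_measurable (P n)"
    unfolding discrepancy_stat_def by measurable
qed (use assms in \<open>auto simp: projection_model_def\<close>)

lemma projection_model_weights_near:
  assumes model: "projection_model M A B L P m x t X Y" and "0 < d"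
  defines "G \<equiv> \<lambda>n. {b \<in> space (P n). dist (X n b) A \<le> d} \<inter> {b \<in> space (P n). dist (Y n b) B \<le> d}"
  shows "G n \<in> sets (P n)" "(\<lambda>n. measure (P n) (G n)) \<longlonglongrightarrow> 1"
proof -
  have [measurable]: "X n \<in> borel_measurable (P n)" "Y n \<in> borel_measurable (P n)" for n
    using projection_modelD[OF model] by auto
  have sets: "{b \<in> space (P n). dist (X n b) A \<le> d} \<in> sets (P n)"
    "{b \<in> space (P n). dist (Y n b) B \<le> d} \<in> sets (P n)" for n
    by measurable
  then show "G n \<in> sets (P n)" by (auto simp: G_def)
  show "(\<lambda>n. measure (P n) (G n)) \<longlonglongrightarrow> 1"
    unfolding G_def using model \<open>0 < d\<close>
    by (intro conv_prob_1_Int sets projection_modelD(1)[OF model] conv_in_prob_near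
        projection_modelD(5,6)[OF model]) (auto simp: projection_model_def)
qed

text \<open>\<open>\<delta>\<close> is chosen before the model, so it is common to almost all
  samples. Closeness of \<open>m n\<close> to \<open>\<theta>\<close> is a premise at each single
  \<open>n\<close> because constrained estimators are only known to converge in probability and need
  not stay near \<open>\<theta>\<close> along a fixed sample.\<close>

lemma (in regular_null) statistic_cdf:
  assumes L: "prob_space L" "sets L = sets borel"
    and atom: "measure L {w. qform B (proj *v w) = y} = 0" and "0 < \<eta>"
  shows "\<exists>\<delta>>0. \<forall>(P :: nat \<Rightarrow> 'b measure) m x t X Y. projection_model M A B L P m x t X Y \<longrightarrow>
    (\<forall>\<^sub>F n in sequentially. dist (m n) \<theta> < \<delta> \<longrightarrow>
      \<bar>measure (P n) {b \<in> space (P n). discrepancy_stat n (Y n b) (x n b) (t n b) \<le> y} -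
        measure L {w. qform B (proj *v w) \<le> y}\<bar> < \<eta>)"
proof -
  have Q: "continuous_on UNIV (\<lambda>w. qform B (proj *v w))"
    by (intro continuous_intros)
  obtain \<epsilon> R where \<epsilon>: "0 < \<epsilon>" and
    cdf: "\<forall>(P :: nat \<Rightarrow> 'b measure) W \<Lambda> G. (\<forall>n. prob_space (P n)) \<longrightarrow>
    (\<forall>n. W n \<in> borel_measurable (P n)) \<longrightarrow> (\<forall>n. \<Lambda> n \<in> borel_measurable (P n)) \<longrightarrow>
    weak_conv_law P W L \<longrightarrow> (\<forall>n. G n \<in> sets (P n)) \<longrightarrow> (\<lambda>n. measure (P n) (G n)) \<longlonglongrightarrow> 1 \<longrightarrow>
    (\<forall>\<^sub>F n in sequentially.
      (AE b in P n. b \<in> G n \<longrightarrow> norm (W n b) \<le> R \<longrightarrow> \<bar>\<Lambda> n b - qform B (proj *v W n b)\<bar> \<le> \<epsilon>) \<longrightarrow>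
      \<bar>measure (P n) {b \<in> space (P n). \<Lambda> n b \<le> y} - measure L {w. qform B (proj *v w) \<le> y}\<bar> < \<eta>)"
    using weak_conv_cdf_perturbed[OF L Q atom \<open>0 < \<eta>\<close>, where 'b = 'b] by blast
  \<comment> \<open>With \<open>\<epsilon>\<close> and \<open>R\<close> already fixed by the limit
    law, one \<open>d\<close> bounds the scale, the base point and both weights; it becomes the
    \<open>\<delta>\<close> of the claim.\<close>
  obtain d where "0 < d" and approx: "\<And>s m X Y w t. \<lbrakk>0 < s; s < d; m \<in> M; dist m \<theta> < d;
    dist X A \<le> d; dist Y B \<le> d; norm w \<le> R;
    is_arg_min (\<lambda>t. qform X (m + s *\<^sub>R w - t)) (\<lambda>t. t \<in> M) t\<rbrakk> \<Longrightarrow>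
    \<bar>qform Y (m + s *\<^sub>R w - t) / s\<^sup>2 - qform B (proj *v w)\<bar> \<le> \<epsilon>"
    using statistic_approximation[OF \<epsilon>, of R] by blast
  have "\<forall>\<^sub>F n in sequentially. dist (m n) \<theta> < d \<longrightarrow>
      \<bar>measure (P n) {b \<in> space (P n). discrepancy_stat n (Y n b) (x n b) (t n b) \<le> y} -
        measure L {w. qform B (proj *v w) \<le> y}\<bar> < \<eta>"
    if model: "projection_model M A B L P m x t X Y" for P :: "nat \<Rightarrow> 'b measure" and m x t X Y
  proof -
    note D = projection_modelD[OF model]
    define W where "W n b = sqrt (real n) *\<^sub>R (x n b - m n)" for n b
    define G where "G n = {b \<in> space (P n). dist (X n b) A \<le> d} \<inter> {b \<in> space (P n). dist (Y n b) B \<le> d}" for n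
    have G: "\<And>n. G n \<in> sets (P n)" "(\<lambda>n. measure (P n) (G n)) \<longlonglongrightarrow> 1"
      unfolding G_def by (rule projection_model_weights_near[OF model \<open>0 < d\<close>])+
    have "\<forall>\<^sub>F n in sequentially.
      (AE b in P n. b \<in> G n \<longrightarrow> norm (W n b) \<le> R \<longrightarrow>
        \<bar>discrepancy_stat n (Y n b) (x n b) (t n b) - qform B (proj *v W n b)\<bar> \<le> \<epsilon>) \<longrightarrow>
      \<bar>measure (P n) {b \<in> space (P n). discrepancy_stat n (Y n b) (x n b) (t n b) \<le> y} -
        measure L {w. qform B (proj *v w) \<le> y}\<bar> < \<eta>"
      using cdf[rule_format, OF D(1) _ D(9) _ G, of W] D(8,10) by (simp add: W_def[abs_def])
    moreover have "(\<lambda>n. 1 / sqrt (real n)) \<longlonglongrightarrow> 0"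
      by (rule tendsto_divide_0[OF tendsto_const])
        (intro filterlim_at_top_imp_at_infinity filterlim_compose[OF sqrt_at_top] filterlim_real_sequentially)
    then have "\<forall>\<^sub>F n in sequentially. 1 / sqrt (real n) < d"
      using \<open>0 < d\<close> by (rule order_tendstoD)
    ultimately show ?thesis
      using eventually_gt_at_top[of 0]
    proof eventually_elim
      case (elim n)
      \<comment> \<open>On this scale \<open>x n b\<close> is
        \<open>m n + s *\<^sub>R W n b\<close>, and division by the square of \<open>s\<close>
        reproduces the factor \<open>n\<close> in the statistic.\<close>
      define s where "s = 1 / sqrt (real n)"
      have s: "0 < s" "s < d" "s\<^sup>2 = 1 / real n" "s * sqrt (real n) = 1"
        using elim(2,3) by (simp_all add: s_def power_divide)
      have x: "x n b = m n + s *\<^sub>R W n b" for b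
        by (simp add: W_def s(4))
      show ?case
      proof
        assume near: "dist (m n) \<theta> < d"
        have "AE b in P n. b \<in> G n \<longrightarrow> norm (W n b) \<le> R \<longrightarrow>
          \<bar>discrepancy_stat n (Y n b) (x n b) (t n b) - qform B (proj *v W n b)\<bar> \<le> \<epsilon>"
          using D(7)[of n]
        proof eventually_elim
          case opt: (elim b)
          show ?case
          proof (intro impI)
            assume b: "b \<in> G n" "norm (W n b) \<le> R"
            have "\<bar>qform (Y n b) (m n + s *\<^sub>R W n b - t n b) / s\<^sup>2 - qform B (proj *v W n b)\<bar> \<le> \<epsilon>"
              using b opt by (intro approx[OF s(1,2) D(2) near]) (auto simp: G_def x)
            then show "\<bar>discrepancy_stat n (Y n b) (x n b) (t n b) - qform B (proj *v W n b)\<bar> \<le> \<epsilon>"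
              by (simp add: discrepancy_stat_def s(3) mult.commute flip: x)
          qed
        qed
        with elim(1) show "\<bar>measure (P n) {b \<in> space (P n). discrepancy_stat n (Y n b) (x n b) (t n b) \<le> y} -
            measure L {w. qform B (proj *v w) \<le> y}\<bar> < \<eta>" by blast
      qed
    qed
  qed
  with \<open>0 < d\<close> show ?thesis by blast
qed

text \<open>The base point \<open>m n\<close> lies in \<open>M\<close>, so optimality against it
  bounds \<open>n\<close> times the squared residual by a multiple of the squared norm of the
  rescaled deviation, which is tight. \<open>C\<close> does not depend on the model, hence not on
  the sample.\<close>

lemma statistic_tight:
  fixes A B :: "real^'p^'p"
  assumes L: "prob_space L" "sets L = sets borel"
    and A: "sym_psd A" "rank A = CARD('p)" and "\<alpha> < 1"
  shows "\<exists>C. \<forall>(P :: nat \<Rightarrow> 'b measure) m x t X Y. projection_model M A B L P m x t X Y \<longrightarrow>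
    (\<forall>\<^sub>F n in sequentially.
      \<alpha> \<le> measure (P n) {b \<in> space (P n). discrepancy_stat n (Y n b) (x n b) (t n b) \<le> C})"
proof -
  \<comment> \<open>Two events, closeness of the weights and boundedness of the deviation, may each
    lose \<open>\<eta>\<close>.\<close>
  define \<eta> where "\<eta> = (1 - \<alpha>) / 2"
  have \<eta>: "0 < \<eta>" "2 * \<eta> = 1 - \<alpha>" using \<open>\<alpha> < 1\<close> by (auto simp: \<eta>_def)
  obtain R where R: "0 < R" "\<forall>(P :: nat \<Rightarrow> 'b measure) W. (\<forall>n. prob_space (P n)) \<longrightarrow>
    (\<forall>n. W n \<in> borel_measurable (P n)) \<longrightarrow> weak_conv_law P W L \<longrightarrow>
    (\<forall>\<^sub>F n in sequentially. 1 - \<eta> < measure (P n) {x \<in> space (P n). norm (W n x) \<le> R})"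
    using weak_conv_tight[OF L \<eta>(1), where 'b = 'b] by blast
  obtain c \<delta> where c: "0 < c" "0 < \<delta>"
    "\<And>Y :: real^'p^'p. \<And>x. dist Y A \<le> \<delta> \<Longrightarrow> c * (norm x)\<^sup>2 \<le> qform Y x"
    using qform_coercive_near[OF A] by metis
  define d where "d = min 1 \<delta>"
  have d: "0 < d" "d \<le> 1" "d \<le> \<delta>" using c(2) by (auto simp: d_def)
  define C where "C = (norm B + 1) * ((norm A + 1) * R\<^sup>2 / c)"
  have "\<forall>\<^sub>F n in sequentially.
      \<alpha> \<le> measure (P n) {b \<in> space (P n). discrepancy_stat n (Y n b) (x n b) (t n b) \<le> C}"
    if model: "projection_model M A B L P m x t X Y" for P :: "nat \<Rightarrow> 'b measure" and m x t X Y
  proof -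
    note D = projection_modelD[OF model]
    define W where "W n b = sqrt (real n) *\<^sub>R (x n b - m n)" for n b
    have W: "W n \<in> borel_measurable (P n)" for n
      using D(8) by (simp add: W_def[abs_def])
    have W_conv: "weak_conv_law P W L"
      using D(10) by (simp add: W_def[abs_def])
    define G where "G n = {b \<in> space (P n). dist (X n b) A \<le> d} \<inter> {b \<in> space (P n). dist (Y n b) B \<le> d}" for n
    have G: "G n \<in> sets (P n)" "(\<lambda>n. measure (P n) (G n)) \<longlonglongrightarrow> 1" for n
      unfolding G_def by (rule projection_model_weights_near[OF model d(1)])+
    have "\<forall>\<^sub>F n in sequentially. 1 - \<eta> < measure (P n) {x \<in> space (P n). norm (W n x) \<le> R}"
      using R(2) D(1) W W_conv by blast
    moreover have "\<forall>\<^sub>F n in sequentially. 1 - \<eta> < measure (P n) (G n)"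
      using \<eta>(1) by (intro order_tendstoD(1)[OF G(2)]) simp
    ultimately show ?thesis
    proof eventually_elim
      case (elim n)
      interpret prob_space "P n" by (rule D)
      have [measurable]: "W n \<in> borel_measurable (P n)" "G n \<in> sets (P n)"
        "(\<lambda>b. discrepancy_stat n (Y n b) (x n b) (t n b)) \<in> borel_measurable (P n)"
        by (fact W G D)+
      have "prob (G n) + prob {b \<in> space (P n). norm (W n b) \<le> R} - 1 \<le>
          prob (G n \<inter> {b \<in> space (P n). norm (W n b) \<le> R})"
        by (rule prob_Int_ge) measurable
      also have "\<dots> \<le> prob {b \<in> space (P n). discrepancy_stat n (Y n b) (x n b) (t n b) \<le> C}"
      proof (rule finite_measure_mono_AE)
        show "AE b in P n. b \<in> G n \<inter> {b \<in> space (P n). norm (W n b) \<le> R} \<longrightarrow>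
          b \<in> {b \<in> space (P n). discrepancy_stat n (Y n b) (x n b) (t n b) \<le> C}"
          using D(7)[of n]
        proof eventually_elim
          case opt: (elim b)
          show ?case
          proof
            assume b: "b \<in> G n \<inter> {b \<in> space (P n). norm (W n b) \<le> R}"
            then have near: "dist (X n b) A \<le> \<delta>" "dist (X n b) A \<le> 1" "dist (Y n b) B \<le> 1"
              using d by (auto simp: G_def)
            have WR: "real n * (norm (x n b - m n))\<^sup>2 \<le> R\<^sup>2"
              using b power_mono[of "norm (W n b)" R 2] by (simp add: W_def power_mult_distrib)
            have "c * (real n * (norm (x n b - t n b))\<^sup>2) \<le>
                (norm A + 1) * (real n * (norm (x n b - m n))\<^sup>2)"
              using mult_left_mono[OF arg_min_residual_bound[OF c(3)[OF near(1)]
                    norm_le_of_dist[OF near(2)] opt D(2)[of n]], of "real n"]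
              by (simp add: mult.left_commute)
            also have "\<dots> \<le> (norm A + 1) * R\<^sup>2"
              using WR by (intro mult_left_mono) auto
            finally have res: "real n * (norm (x n b - t n b))\<^sup>2 \<le> (norm A + 1) * R\<^sup>2 / c"
              using c(1) by (simp add: field_simps)
            have "discrepancy_stat n (Y n b) (x n b) (t n b) \<le>
                real n * (norm (Y n b) * (norm (x n b - t n b))\<^sup>2)"
              unfolding discrepancy_stat_def
              by (intro mult_left_mono order_trans[OF abs_ge_self abs_qform_le]) auto
            also have "\<dots> = norm (Y n b) * (real n * (norm (x n b - t n b))\<^sup>2)"
              by (rule mult.left_commute)
            also have "\<dots> \<le> C"
              unfolding C_def using norm_le_of_dist[OF near(3)] res by (intro mult_mono) auto
            finally show "b \<in> {b \<in> space (P n). discrepancy_stat n (Y n b) (x n b) (t n b) \<le> C}"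
              using b by simp
          qed
        qed
      qed measurable
      finally show ?case
        using elim \<eta>(2) by linarith
    qed
  qed
  then show ?thesis by blast
qed

lemma measure_density_negligible:
  fixes f :: "'a::euclidean_space \<Rightarrow> ennreal"
  assumes "f \<in> borel_measurable borel" "negligible N" "N \<in> sets borel"
  shows "measure (density lborel f) N = 0"
proof -
  have "N \<in> null_sets lborel"
    using assms(2,3) null_sets_completion_iff[of N lborel] by (simp add: negligible_iff_null_sets)
  then have "N \<in> null_sets (density lborel f)"
    using absolutely_continuousI_density[of f lborel] assms(1)
    by (auto simp: absolutely_continuous_def)
  then show ?thesis by (simp add: null_sets_def measure_def)
qed

theorem theorem4:
  fixes M :: "(real^'p) set"
    and \<theta>\<^sub>0 :: "real^'p"
    and A B :: "real^'p^'p"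
    and L :: "(real^'p) measure"
    and S :: "'s measure"
    and N :: "'b measure"
    and K :: "nat \<Rightarrow> 's \<Rightarrow> 'b measure"
    and \<theta>hat \<theta>c_hat :: "nat \<Rightarrow> 's \<Rightarrow> real^'p"
    and Ahat Bhat :: "nat \<Rightarrow> 's \<Rightarrow> real^'p^'p"
    and Wstar \<theta>0_star \<theta>c_star :: "nat \<Rightarrow> 's \<Rightarrow> 'b \<Rightarrow> real^'p"
    and Astar Bstar :: "nat \<Rightarrow> 's \<Rightarrow> 'b \<Rightarrow> real^'p^'p"
    and \<Lambda>hat :: "nat \<Rightarrow> 's \<Rightarrow> real"
    and \<Lambda>star :: "nat \<Rightarrow> 's \<Rightarrow> 'b \<Rightarrow> real"
    and qhat :: "real \<Rightarrow> nat \<Rightarrow> 's \<Rightarrow> real"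
    and \<alpha> :: real
  \<comment> \<open>\<open>S\<close> is the law of the sample sequence; \<open>K n \<omega>\<close> is the law of the bootstrap randomness
     given the sample of size \<open>n\<close>\<close>
  assumes sample_space: "prob_space S"
    and bootstrap_kernel: "\<And>n. K n \<in> S \<rightarrow>\<^sub>M prob_algebra N"
    and hat_measurable:
      "\<And>n. \<theta>hat n \<in> borel_measurable S"
      "\<And>n. \<theta>c_hat n \<in> borel_measurable S"
      "\<And>n. Ahat n \<in> borel_measurable S"
      "\<And>n. Bhat n \<in> borel_measurable S"
    and star_measurable:
      "\<And>n. (\<lambda>(\<omega>, b). Wstar n \<omega> b) \<in> borel_measurable (S \<Otimes>\<^sub>M N)"
      "\<And>n. (\<lambda>(\<omega>, b). \<theta>c_star n \<omega> b) \<in> borel_measurable (S \<Otimes>\<^sub>M N)"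
      "\<And>n. (\<lambda>(\<omega>, b). Astar n \<omega> b) \<in> borel_measurable (S \<Otimes>\<^sub>M N)"
      "\<And>n. (\<lambda>(\<omega>, b). Bstar n \<omega> b) \<in> borel_measurable (S \<Otimes>\<^sub>M N)"
    and hat_psd: "\<And>n. AE \<omega> in S. sym_psd (Ahat n \<omega>) \<and> sym_psd (Bhat n \<omega>)"
    and star_psd: "\<And>n. AE \<omega> in S. AE b in K n \<omega>. sym_psd (Astar n \<omega> b) \<and> sym_psd (Bstar n \<omega> b)"
    and \<theta>c_hat_argmin: "\<And>n. AE \<omega> in S.
      is_arg_min (\<lambda>\<theta>. qform (Ahat n \<omega>) (\<theta>hat n \<omega> - \<theta>)) (\<lambda>\<theta>. \<theta> \<in> M) (\<theta>c_hat n \<omega>)"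
    and \<Lambda>hat_eq: "\<And>n \<omega>. \<Lambda>hat n \<omega> = discrepancy_stat n (Bhat n \<omega>) (\<theta>hat n \<omega>) (\<theta>c_hat n \<omega>)"
    and \<theta>0_star_eq: "\<And>n \<omega> b. \<theta>0_star n \<omega> b = \<theta>c_hat n \<omega> + (1 / sqrt (real n)) *\<^sub>R Wstar n \<omega> b"
    and \<theta>c_star_argmin: "\<And>n. AE \<omega> in S. AE b in K n \<omega>.
      is_arg_min (\<lambda>\<theta>. qform (Astar n \<omega> b) (\<theta>0_star n \<omega> b - \<theta>)) (\<lambda>\<theta>. \<theta> \<in> M) (\<theta>c_star n \<omega> b)"
    and \<Lambda>star_eq: "\<And>n \<omega> b.
      \<Lambda>star n \<omega> b = discrepancy_stat n (Bstar n \<omega> b) (\<theta>0_star n \<omega> b) (\<theta>c_star n \<omega> b)"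
    and qhat_eq: "\<And>a n \<omega>. qhat a n \<omega> = quantile (K n \<omega>) (\<Lambda>star n \<omega>) a"
    and M_submanifold: "submanifold TYPE('q::finite) M"
    and \<theta>hat_conv: "AE \<omega> in S. (\<lambda>n. \<theta>hat n \<omega>) \<longlonglongrightarrow> \<theta>\<^sub>0"
    and \<theta>0_nonsingular: "\<theta>\<^sub>0 \<in> M \<Longrightarrow> nonsingular TYPE('q) M \<theta>\<^sub>0"
    and Ahat_conv: "conv_in_prob (\<lambda>_. S) Ahat A"
    and A_full_rank: "rank A = CARD('p)"
    and Bhat_conv: "conv_in_prob (\<lambda>_. S) Bhat B"
    and B_null: "\<theta>\<^sub>0 \<in> M \<Longrightarrow> nondegenerate_null TYPE('q) A B M \<theta>\<^sub>0"
    and B_alt: "\<theta>\<^sub>0 \<notin> M \<Longrightarrow> nondegenerate_alt A B M \<theta>\<^sub>0"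
    and limit_law: "prob_space L"
    and limit_density: "\<exists>f \<in> borel_measurable borel. L = density lborel f"
    and \<theta>hat_limit: "weak_conv_law (\<lambda>_. S) (\<lambda>n \<omega>. sqrt (real n) *\<^sub>R (\<theta>hat n \<omega> - \<theta>\<^sub>0)) L"
    and \<theta>0_star_limit: "AE \<omega> in S.
      weak_conv_law (\<lambda>n. K n \<omega>) (\<lambda>n b. sqrt (real n) *\<^sub>R (\<theta>0_star n \<omega> b - \<theta>c_hat n \<omega>)) L"
    and Astar_conv: "AE \<omega> in S. conv_in_prob (\<lambda>n. K n \<omega>) (\<lambda>n. Astar n \<omega>) A"
    and Bstar_conv: "AE \<omega> in S. conv_in_prob (\<lambda>n. K n \<omega>) (\<lambda>n. Bstar n \<omega>) B"
    and \<alpha>: "0 < \<alpha>" "\<alpha> < 1"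
  shows "(\<theta>\<^sub>0 \<in> M \<longrightarrow>
            (\<lambda>n. measure S {\<omega> \<in> space S. \<Lambda>hat n \<omega> > qhat \<alpha> n \<omega>}) \<longlonglongrightarrow> 1 - \<alpha>) \<and>
         (\<theta>\<^sub>0 \<notin> M \<longrightarrow>
            (\<lambda>n. measure S {\<omega> \<in> space S. \<Lambda>hat n \<omega> > qhat \<alpha> n \<omega>}) \<longlonglongrightarrow> 1)"
proof -

  \<comment> \<open>Measurability of the conditional quantities and almost sure bootstrap
    models\<close>
  interpret S: prob_space S by fact
  note [measurable] = hat_measurable star_measurable
  have kernel: "prob_space (K n \<omega>)" "sets (K n \<omega>) = sets N" if "\<omega> \<in> space S" for n \<omega>
    using measurable_space[OF bootstrap_kernel that, of n] by (auto simp: space_prob_algebra)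
  have [measurable]: "(\<lambda>(\<omega>, b). \<theta>0_star n \<omega> b) \<in> borel_measurable (S \<Otimes>\<^sub>M N)" for n
    unfolding \<theta>0_star_eq by measurable
  have \<Lambda>star_meas [measurable]: "(\<lambda>(\<omega>, b). \<Lambda>star n \<omega> b) \<in> borel_measurable (S \<Otimes>\<^sub>M N)" for n
    unfolding \<Lambda>star_eq discrepancy_stat_def by measurable
  have [measurable]: "\<Lambda>hat n \<in> borel_measurable S" for n
    unfolding \<Lambda>hat_eq[abs_def] discrepancy_stat_def by measurable
  have star: "Z \<omega> \<in> borel_measurable (K n \<omega>)"
    if "(\<lambda>(\<omega>, b). Z \<omega> b) \<in> borel_measurable (S \<Otimes>\<^sub>M N)" "\<omega> \<in> space S"
    for Z :: "'s \<Rightarrow> 'b \<Rightarrow> 'z::euclidean_space" and n \<omega>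
    using measurable_compose[OF measurable_Pair1'[OF that(2)] that(1)]
    unfolding measurable_cong_sets[OF kernel(2)[OF that(2), of n] refl] by simp
  define F where "F n \<omega> y = measure (K n \<omega>) {b \<in> space (K n \<omega>). \<Lambda>star n \<omega> b \<le> y}" for n \<omega> y
  have F_meas [measurable]: "(\<lambda>\<omega>. F n \<omega> y) \<in> borel_measurable S" for n y
    unfolding F_def
  proof (rule measure_measurable_prob_algebra2[OF _ bootstrap_kernel])
    have "(SIGMA \<omega>:space S. {b \<in> space (K n \<omega>). \<Lambda>star n \<omega> b \<le> y}) =
        {p \<in> space (S \<Otimes>\<^sub>M N). (\<lambda>(\<omega>, b). \<Lambda>star n \<omega> b) p \<le> y}"
      using sets_eq_imp_space_eq[OF kernel(2)] by (auto simp: space_pair_measure)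
    also have "\<dots> \<in> sets (S \<Otimes>\<^sub>M N)" by measurable
    finally show "(SIGMA \<omega>:space S. {b \<in> space (K n \<omega>). \<Lambda>star n \<omega> b \<le> y}) \<in> sets (S \<Otimes>\<^sub>M N)" .
  qed
  have qhat_le: "qhat \<alpha> n \<omega> \<le> y \<longleftrightarrow> \<alpha> \<le> F n \<omega> y" if "\<omega> \<in> space S" for n \<omega> y
    unfolding qhat_eq F_def
    by (rule quantile_le_iff[OF kernel(1)[OF that] star[OF \<Lambda>star_meas that] \<alpha>])
  \<comment> \<open>The sublevel sets of the quantile are superlevel sets of the conditional
    distribution function at one point, which is measurable in the sample by the kernel
    property.\<close>
  have [measurable]: "qhat \<alpha> n \<in> borel_measurable S" for n
  proof (rule borel_measurableI_le)
    fix y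
    have "{\<omega> \<in> space S. qhat \<alpha> n \<omega> \<le> y} = {\<omega> \<in> space S. \<alpha> \<le> F n \<omega> y}"
      using qhat_le by blast
    also have "\<dots> \<in> sets S" by measurable
    finally show "{\<omega> \<in> space S. qhat \<alpha> n \<omega> \<le> y} \<in> sets S" .
  qed
  obtain f where f: "f \<in> borel_measurable borel" "L = density lborel f"
    using limit_density by blast
  then have sets_L: "sets L = sets borel" by simp
  \<comment> \<open>The limits inherit positive semi-definiteness from the random weights.\<close>
  have psd: "sym_psd A" "sym_psd B"
    using S.conv_in_prob_closed[OF Ahat_conv hat_measurable(3) closed_sym_psd]
      S.conv_in_prob_closed[OF Bhat_conv hat_measurable(4) closed_sym_psd] hat_psd by auto
  \<comment> \<open>The null sets for the individual \<open>n\<close> are countably many, so almost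
    every sample satisfies the requirements for all \<open>n\<close> at once.\<close>
  have star_model: "AE \<omega> in S. projection_model M A B L (\<lambda>n. K n \<omega>) (\<lambda>n. \<theta>c_hat n \<omega>)
      (\<lambda>n. \<theta>0_star n \<omega>) (\<lambda>n. \<theta>c_star n \<omega>) (\<lambda>n. Astar n \<omega>) (\<lambda>n. Bstar n \<omega>)"
  proof -
    have "AE \<omega> in S. \<forall>n. \<theta>c_hat n \<omega> \<in> M"
      unfolding AE_all_countable using \<theta>c_hat_argmin by (auto simp: is_arg_min_def elim: eventually_mono)
    moreover have "AE \<omega> in S. \<forall>n. AE b in K n \<omega>.
        is_arg_min (\<lambda>\<theta>. qform (Astar n \<omega> b) (\<theta>0_star n \<omega> b - \<theta>)) (\<lambda>\<theta>. \<theta> \<in> M) (\<theta>c_star n \<omega> b)"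
      unfolding AE_all_countable using \<theta>c_star_argmin by blast
    ultimately show ?thesis
      using \<theta>0_star_limit Astar_conv Bstar_conv AE_space
    proof eventually_elim
      case (elim \<omega>)
      then show ?case
        unfolding projection_model_def by (auto intro!: kernel star)
    qed
  qed
  have \<theta>hat_near: "(\<lambda>n. S.prob {\<omega> \<in> space S. dist (\<theta>hat n \<omega>) \<theta>\<^sub>0 \<le> d}) \<longlonglongrightarrow> 1" if "0 < d" for d
  proof (rule S.conv_prob_1_AE)
    show "AE \<omega> in S. \<forall>\<^sub>F n in sequentially. dist (\<theta>hat n \<omega>) \<theta>\<^sub>0 \<le> d"
      using \<theta>hat_conv by eventually_elim (drule tendstoD[OF _ that], erule eventually_mono, simp)
  qed measurable
  have Ahat_near: "(\<lambda>n. S.prob {\<omega> \<in> space S. dist (Ahat n \<omega>) A \<le> d}) \<longlonglongrightarrow> 1"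
    and Bhat_near: "(\<lambda>n. S.prob {\<omega> \<in> space S. dist (Bhat n \<omega>) B \<le> d}) \<longlonglongrightarrow> 1" if "0 < d" for d
    using that hat_measurable
    by (intro conv_in_prob_near[OF Ahat_conv sample_space] conv_in_prob_near[OF Bhat_conv sample_space]; simp)+

  \<comment> \<open>Level under the null hypothesis\<close>
  have null: "(\<lambda>n. S.prob {\<omega> \<in> space S. qhat \<alpha> n \<omega> < \<Lambda>hat n \<omega>}) \<longlonglongrightarrow> 1 - \<alpha>"
    if \<theta>M: "\<theta>\<^sub>0 \<in> M"
  proof -
    obtain V and g :: "real^'p \<Rightarrow> real^'q" where g: "defining_map M \<theta>\<^sub>0 V g"
      using \<theta>0_nonsingular[OF \<theta>M] by (auto simp: nonsingular_def)
    interpret R: regular_null M \<theta>\<^sub>0 V g A B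
      by standard (use g \<theta>M psd A_full_rank in auto)
    have nondeg: "B ** matrix_inv A ** transpose R.J \<noteq> 0"
      using B_null[OF \<theta>M] g by (auto simp: nondegenerate_null_def R.J_def)
    define Q where "Q w = qform B (R.proj *v w)" for w
    have Q_meas: "Q \<in> borel_measurable L"
      unfolding Q_def[abs_def] measurable_cong_sets[OF sets_L refl]
      by (intro borel_measurable_continuous_onI continuous_intros)
    have space_L: "space L = UNIV" using sets_eq_imp_space_eq[OF sets_L] by simp
    have atom: "measure L {w. Q w = y} = 0" for y
    proof -
      have "closed {w. Q w = y}"
        unfolding Q_def by (intro closed_Collect_eq continuous_intros)
      then show ?thesis
        unfolding f(2) using f(1) R.negligible_level_set[OF nondeg, of y]
        by (intro measure_density_negligible) (auto simp: Q_def)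
    qed
    define D where "D = distr L borel Q"
    have D: "real_distribution D"
      unfolding D_def using limit_law Q_meas by (simp add: prob_space.real_distribution_distr)
    have cdf_D: "cdf D y = measure L {w. Q w \<le> y}" for y
      using Q_meas by (simp add: D_def cdf_def measure_distr space_L vimage_def)
    have cont: "isCont (cdf D) y" for y
    proof -
      interpret D: real_distribution D by (rule D)
      have "measure D {y} = 0"
        using Q_meas atom[of y] by (simp add: D_def measure_distr space_L vimage_def)
      then show ?thesis by (simp add: D.isCont_cdf)
    qed
    show ?thesis
    proof (rule S.bootstrap_test_level[OF D cont _ F_meas _ qhat_le])
      fix y
      show "(\<lambda>n. S.prob {\<omega> \<in> space S. \<Lambda>hat n \<omega> \<le> y}) \<longlonglongrightarrow> cdf D y"
      proof (rule metric_LIMSEQ_I)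
        fix \<eta> :: real assume \<eta>: "0 < \<eta>"
        obtain \<delta> where \<delta>: "0 < \<delta>" and
          cdf: "\<And>(P :: nat \<Rightarrow> 's measure) m x t X Y. projection_model M A B L P m x t X Y \<Longrightarrow>
            \<forall>\<^sub>F n in sequentially. dist (m n) \<theta>\<^sub>0 < \<delta> \<longrightarrow>
              \<bar>measure (P n) {b \<in> space (P n). discrepancy_stat n (Y n b) (x n b) (t n b) \<le> y} -
                measure L {w. qform B (R.proj *v w) \<le> y}\<bar> < \<eta>"
          using R.statistic_cdf[OF limit_law sets_L atom[unfolded Q_def] \<eta>, of y, where 'b = 's] by blast
        \<comment> \<open>The base point is constantly \<open>\<theta>\<^sub>0\<close>, so the
          closeness premise of \<open>cdf\<close> is trivially met.\<close>
        have "projection_model M A B L (\<lambda>_. S) (\<lambda>_. \<theta>\<^sub>0) \<theta>hat \<theta>c_hat Ahat Bhat"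
          unfolding projection_model_def
          using sample_space \<theta>M hat_measurable \<theta>c_hat_argmin \<theta>hat_limit Ahat_conv Bhat_conv by blast
        from cdf[OF this]
        have "\<forall>\<^sub>F n in sequentially. \<bar>S.prob {\<omega> \<in> space S. \<Lambda>hat n \<omega> \<le> y} - cdf D y\<bar> < \<eta>"
          using \<delta> by (simp add: cdf_D Q_def \<Lambda>hat_eq)
        then show "\<exists>N. \<forall>n\<ge>N. dist (S.prob {\<omega> \<in> space S. \<Lambda>hat n \<omega> \<le> y}) (cdf D y) < \<eta>"
          by (simp add: eventually_sequentially dist_real_def)
      qed
      fix \<eta> :: real assume \<eta>: "0 < \<eta>"
      obtain \<delta> where \<delta>: "0 < \<delta>" and
        cdf: "\<forall>(P :: nat \<Rightarrow> 'b measure) m x t X Y. projection_model M A B L P m x t X Y \<longrightarrow>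
          (\<forall>\<^sub>F n in sequentially. dist (m n) \<theta>\<^sub>0 < \<delta> \<longrightarrow>
            \<bar>measure (P n) {b \<in> space (P n). discrepancy_stat n (Y n b) (x n b) (t n b) \<le> y} -
              measure L {w. qform B (R.proj *v w) \<le> y}\<bar> < \<eta>)"
        using R.statistic_cdf[OF limit_law sets_L atom[unfolded Q_def] \<eta>, of y, where 'b = 'b] by blast
      \<comment> \<open>\<open>E n\<close> keeps closeness of the constrained estimator as a premise
        and so holds eventually for almost every sample. The premise itself is secured on
        \<open>G n\<close>, whose probability tends to one; on the intersection the distribution
        functions are close.\<close>
      define E where "E n = {\<omega> \<in> space S. dist (\<theta>c_hat n \<omega>) \<theta>\<^sub>0 < \<delta> \<longrightarrow> \<bar>F n \<omega> y - cdf D y\<bar> < \<eta>}" for n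
      have E_meas: "E n \<in> sets S" for n unfolding E_def by measurable
      have E_lim: "(\<lambda>n. S.prob (E n)) \<longlonglongrightarrow> 1"
        unfolding E_def
      proof (rule S.conv_prob_1_AE)
        show "AE \<omega> in S. \<forall>\<^sub>F n in sequentially.
            dist (\<theta>c_hat n \<omega>) \<theta>\<^sub>0 < \<delta> \<longrightarrow> \<bar>F n \<omega> y - cdf D y\<bar> < \<eta>"
          using star_model
        proof eventually_elim
          case (elim \<omega>)
          then show ?case
            using cdf by (simp add: F_def \<Lambda>star_eq cdf_D Q_def)
        qed
      qed measurable
      obtain d where d: "0 < d" "\<And>X x t. \<lbrakk>dist X A \<le> d; dist x \<theta>\<^sub>0 \<le> d;
          is_arg_min (\<lambda>t. qform X (x - t)) (\<lambda>t. t \<in> M) t\<rbrakk> \<Longrightarrow> dist t \<theta>\<^sub>0 < \<delta>"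
        using arg_min_near[OF psd(1) A_full_rank \<theta>M \<delta>] by blast
      define G where "G n = {\<omega> \<in> space S. dist (Ahat n \<omega>) A \<le> d} \<inter>
        {\<omega> \<in> space S. dist (\<theta>hat n \<omega>) \<theta>\<^sub>0 \<le> d}" for n
      have G_meas: "G n \<in> sets S" for n unfolding G_def by measurable
      have G_lim: "(\<lambda>n. S.prob (G n)) \<longlonglongrightarrow> 1"
        unfolding G_def
        by (intro conv_prob_1_Int sample_space Ahat_near \<theta>hat_near d(1)) measurable
      show "(\<lambda>n. S.prob {\<omega> \<in> space S. \<bar>F n \<omega> y - cdf D y\<bar> < \<eta>}) \<longlonglongrightarrow> 1"
      proof (rule tendsto_sandwich[where h = "\<lambda>_. 1"])
        show "(\<lambda>n. S.prob (E n \<inter> G n)) \<longlonglongrightarrow> 1"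
          by (intro conv_prob_1_Int sample_space E_meas G_meas E_lim G_lim)
        have "S.prob (E n \<inter> G n) \<le> S.prob {\<omega> \<in> space S. \<bar>F n \<omega> y - cdf D y\<bar> < \<eta>}" for n
        proof (rule S.finite_measure_mono_AE)
          show "AE \<omega> in S. \<omega> \<in> E n \<inter> G n \<longrightarrow> \<omega> \<in> {\<omega> \<in> space S. \<bar>F n \<omega> y - cdf D y\<bar> < \<eta>}"
            using \<theta>c_hat_argmin[of n] by eventually_elim (use d(2) in \<open>auto simp: E_def G_def\<close>)
        qed measurable
        then show "\<forall>\<^sub>F n in sequentially.
            S.prob (E n \<inter> G n) \<le> S.prob {\<omega> \<in> space S. \<bar>F n \<omega> y - cdf D y\<bar> < \<eta>}" by simp
      qed (simp_all add: S.prob_le_1)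
    qed (use \<alpha> in measurable)
  qed

  \<comment> \<open>Power under the alternative\<close>
  have alt: "(\<lambda>n. S.prob {\<omega> \<in> space S. qhat \<alpha> n \<omega> < \<Lambda>hat n \<omega>}) \<longlonglongrightarrow> 1"
    if \<theta>M: "\<theta>\<^sub>0 \<notin> M"
  proof -
    obtain d where d: "0 < d" "\<And>X Y x t. \<lbrakk>dist X A \<le> d; dist Y B \<le> d; dist x \<theta>\<^sub>0 \<le> d;
        is_arg_min (\<lambda>t. qform X (x - t)) (\<lambda>t. t \<in> M) t\<rbrakk> \<Longrightarrow> d \<le> qform Y (x - t)"
      using residual_bounded_below[OF psd(1) A_full_rank psd(2) B_alt[OF \<theta>M]] by blast
    \<comment> \<open>The bootstrap is centred at a point of \<open>M\<close> also when
      \<open>\<theta>\<^sub>0\<close> lies outside, so its conditional laws still fit the model and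
      \<open>C\<close> eventually bounds the quantile for almost every sample.\<close>
    obtain C where C: "\<forall>(P :: nat \<Rightarrow> 'b measure) m x t X Y. projection_model M A B L P m x t X Y \<longrightarrow>
      (\<forall>\<^sub>F n in sequentially.
        \<alpha> \<le> measure (P n) {b \<in> space (P n). discrepancy_stat n (Y n b) (x n b) (t n b) \<le> C})"
      using statistic_tight[OF limit_law sets_L psd(1) A_full_rank \<alpha>(2), where 'b = 'b] by blast
    define E where "E n = {\<omega> \<in> space S. \<alpha> \<le> F n \<omega> C}" for n
    have E_meas: "E n \<in> sets S" for n unfolding E_def by measurable
    have E_lim: "(\<lambda>n. S.prob (E n)) \<longlonglongrightarrow> 1"
      unfolding E_def
    proof (rule S.conv_prob_1_AE)
      show "AE \<omega> in S. \<forall>\<^sub>F n in sequentially. \<alpha> \<le> F n \<omega> C"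
        using star_model by eventually_elim (use C in \<open>simp add: F_def \<Lambda>star_eq\<close>)
    qed measurable
    define G where "G n = {\<omega> \<in> space S. dist (Ahat n \<omega>) A \<le> d} \<inter>
      ({\<omega> \<in> space S. dist (Bhat n \<omega>) B \<le> d} \<inter> {\<omega> \<in> space S. dist (\<theta>hat n \<omega>) \<theta>\<^sub>0 \<le> d})" for n
    have G_meas: "G n \<in> sets S" for n unfolding G_def by measurable
    have G_lim: "(\<lambda>n. S.prob (G n)) \<longlonglongrightarrow> 1"
      unfolding G_def
      by (intro conv_prob_1_Int sample_space Ahat_near Bhat_near \<theta>hat_near d(1)) measurable
    show ?thesis
    proof (rule tendsto_sandwich[where h = "\<lambda>_. 1"])
      show "(\<lambda>n. S.prob (E n \<inter> G n)) \<longlonglongrightarrow> 1"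
        by (intro conv_prob_1_Int sample_space E_meas G_meas E_lim G_lim)
      \<comment> \<open>From \<open>n0\<close> on, the lower bound \<open>real n * d\<close> for the
        sample statistic on \<open>G n\<close> exceeds the bound \<open>C\<close> for the quantile
        on \<open>E n\<close>.\<close>
      obtain n0 :: nat where n0: "C < real n0 * d"
        using reals_Archimedean3[OF d(1)] by blast
      show "\<forall>\<^sub>F n in sequentially.
          S.prob (E n \<inter> G n) \<le> S.prob {\<omega> \<in> space S. qhat \<alpha> n \<omega> < \<Lambda>hat n \<omega>}"
        using eventually_ge_at_top[of n0]
      proof eventually_elim
        case (elim n)
        have "real n0 * d \<le> real n * d"
          using elim d(1) by (intro mult_right_mono) auto
        with n0 have n: "C < real n * d" by linarith
        show ?case
        proof (rule S.finite_measure_mono_AE)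
          show "AE \<omega> in S. \<omega> \<in> E n \<inter> G n \<longrightarrow> \<omega> \<in> {\<omega> \<in> space S. qhat \<alpha> n \<omega> < \<Lambda>hat n \<omega>}"
            using \<theta>c_hat_argmin[of n]
          proof eventually_elim
            case opt: (elim \<omega>)
            show ?case
            proof
              assume \<omega>: "\<omega> \<in> E n \<inter> G n"
              then have "qhat \<alpha> n \<omega> \<le> C"
                using qhat_le by (auto simp: E_def)
              also have "C < real n * d" by (rule n)
              also have "\<dots> \<le> \<Lambda>hat n \<omega>"
                unfolding \<Lambda>hat_eq discrepancy_stat_def using \<omega> opt
                by (intro mult_left_mono d(2)) (auto simp: G_def)
              finally show "\<omega> \<in> {\<omega> \<in> space S. qhat \<alpha> n \<omega> < \<Lambda>hat n \<omega>}"
                using \<omega> by (simp add: E_def)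
            qed
          qed
        qed measurable
      qed
    qed (simp_all add: S.prob_le_1)
  qed
  from null alt show ?thesis by blast
qed

end
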